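(* Let $\lambda$ be a regular content on a Hausdorff space $X$, and let $S\subset X$ be a subset. The induced measure of $S$ is given by $$\lambda_*(S)=\sup\{\lambda(K)\mid K\subset S\text{ compact}\}.$$
   Context: A frame is a poset with arbitrary suprema and finite infima satisfying $V\wedge\bigvee_i U_i=\bigvee_i(V\wedge U_i)$; locales are the objects of the opposite category of frames, $\mathcal{O}(L)$ is the frame of $L$, and a continuous map $f:L\to M$ is a frame homomorphism $f^*:\mathcal{O}(M)\to\mathcal{O}(L)$ with right adjoint $f_*$. Hausdorff spaces are identified with the locales of their frames of opens. A locale is Boolean if every open has a complement. A sublocale of $L$ is a subset $S\subset\mathcal{O}(L)$ that is a frame in the induced order and whose inclusion is right adjoint to a frame homomorphism $\mathcal{O}(L)\to S$. The poset $\mathrm{Sl}(L)$ of sublocales ordered by inclusion is a coframe; $\mathfrak{Sl}(L)$ is the locale with frame $\mathrm{Sl}(L)^{op}$. The natural map $\mathrm{can}:\mathfrak{Sl}(L)\to L$ has $\mathrm{can}^*(U)=U^c=\{V\mid U\le V\}$. If $M$ is Boolean, every continuous map $f:M\to L$ has a unique lift $\tilde f:M\to\mathfrak{Sl}(L)$ with $\mathrm{can}\circ\tilde f=f$. $\mathcal{K}(X)$ is the lattice of compact subsets of $X$. A content is a function $\lambda:\mathcal{K}(X)\to[0,+\infty)$ that is monotone, subadditive ($\lambda(C\cup D)\le\lambda(C)+\lambda(D)$), and additive on disjoint pairs. Write $K_1\ll K_2$ if there is an open $U$ with $K_1\subset U\subset K_2$. A content is regular if $\lambda(K)=\inf\{\lambda(K')\mid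 K\ll K',\ K'\text{ compact}\}$ for all compact $K$ (infimum in $[0,+\infty]$). On a Hausdorff space a regular content is modular: $\lambda(C)+\lambda(D)=\lambda(C\cup D)+\lambda(C\cap D)$. A $\lambda$-ideal is a downward closed $U\subset\mathcal{K}(X)$ such that $K\in U$ whenever there are $K_i\in U$ $(i\in I)$, $K_i\subset K$, such that for all $\epsilon>0$ some finite $F\subset I$ has $\lambda(K)-\lambda(\bigcup_{i\in F}K_i)<\epsilon$. The $\lambda$-ideals ordered by inclusion form the frame of a locale $X^\lambda$, which is Boolean and carries the inner measure $\lambda_*(U)=\sup_{K\in U}\lambda(K)$. The map $p_\lambda:X^\lambda\to X$ has inverse image sending an open $V\subset X$ to the smallest $\lambda$-ideal containing $\{K\subset V\mid K\text{ compact}\}$; $\tilde p:X^\lambda\to\mathfrak{Sl}(X)$ is its unique lift along $\mathrm{can}$. The measure $\lambda_*$ on $\mathfrak{Sl}(X)$ is $\lambda_*(T)=\lambda_*(\tilde p^*(T))$ for $T\in\mathrm{Sl}(X)^{op}$. Let $X^{disc}$ be the underlying set of $X$ with the discrete topology (frame $\mathcal{P}(X)$, a Boolean locale) and let $\varphi:X^{disc}\to\mathfrak{Sl}(X)$ be the unique lift along $\mathrm{can}$ of the identity map $X^{disc}\to X$. With $\varphi_*:\mathcal{P}(X)\to\mathrm{Sl}(X)^{op}$ the right adjoint of $\varphi^*$, the induced measure of a subset $S\subset X$ is defined as $\lambda_*(S)=\lambda_*(\varphi_*(S))$. *)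

theory Defs
  imports "HOL-Analysis.Analysis" "HOL-Algebra.Galois_Connection"
begin

section \<open>Frames and sublocales\<close>

text \<open>
  Frames are carrier-based orders of HOL-Algebra.  A locale is represented by its frame of opens,
  and a continuous map \<open>f : L \<rightarrow> M\<close> by the frame homomorphism \<open>f\<^sup>*\<close> from (the frame of) \<open>M\<close> to
  (the frame of) \<open>L\<close>.
\<close>

locale frame = complete_lattice L for L (structure) +
  assumes meet_Sup_distrib:
    "\<lbrakk>v \<in> carrier L; A \<subseteq> carrier L\<rbrakk> \<Longrightarrow> v \<sqinter> \<Squnion>A = \<Squnion>((\<lambda>u. v \<sqinter> u) ` A)"

definition frame_hom :: "'a gorder \<Rightarrow> 'b gorder \<Rightarrow> ('a \<Rightarrow> 'b) \<Rightarrow> bool" where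
  "frame_hom L M h \<longleftrightarrow>
     frame L \<and> frame M \<and> h \<in> carrier L \<rightarrow> carrier M \<and>
     (\<forall>A. A \<subseteq> carrier L \<longrightarrow> h (\<Squnion>\<^bsub>L\<^esub>A) = \<Squnion>\<^bsub>M\<^esub>(h ` A)) \<and>
     h \<top>\<^bsub>L\<^esub> = \<top>\<^bsub>M\<^esub> \<and>
     (\<forall>x\<in>carrier L. \<forall>y\<in>carrier L. h (x \<sqinter>\<^bsub>L\<^esub> y) = h x \<sqinter>\<^bsub>M\<^esub> h y)"

text \<open>
  Maps are only determined on carriers; extensionality is what makes the descriptions
  below (here and in \<open>lift\<close>) pick out a unique HOL function.
\<close>

definition right_adjoint :: "'a gorder \<Rightarrow> 'b gorder \<Rightarrow> ('a \<Rightarrow> 'b) \<Rightarrow> 'b \<Rightarrow> 'a" where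
  "right_adjoint L M h =
     (THE g. g \<in> extensional (carrier M) \<and>
        galois_connection \<lparr>orderA = L, orderB = M, lower = h, upper = g\<rparr>)"

definition is_sublocale :: "'a gorder \<Rightarrow> 'a set \<Rightarrow> bool" where
  "is_sublocale L S \<longleftrightarrow>
     S \<subseteq> carrier L \<and> frame (L\<lparr>carrier := S\<rparr>) \<and>
     (\<exists>h. frame_hom L (L\<lparr>carrier := S\<rparr>) h \<and>
        galois_connection \<lparr>orderA = L, orderB = L\<lparr>carrier := S\<rparr>, lower = h, upper = (\<lambda>x. x)\<rparr>)"

definition set_order :: "'a set set \<Rightarrow> 'a set gorder" where
  "set_order A = \<lparr>carrier = A, eq = (=), le = (\<subseteq>)\<rparr>"

text \<open>The frame of the locale of sublocales: sublocales ordered by reverse inclusion.\<close>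

definition Sl_frame :: "'a gorder \<Rightarrow> 'a set gorder" where
  "Sl_frame L = inv_gorder (set_order {S. is_sublocale L S})"

definition can :: "'a gorder \<Rightarrow> 'a \<Rightarrow> 'a set" where
  "can L u = {v \<in> carrier L. u \<sqsubseteq>\<^bsub>L\<^esub> v}"

text \<open>
  For \<open>f\<close> the inverse image of a continuous map from the locale \<open>M\<close> to the locale \<open>L\<close>,
  \<open>lift L M f\<close> is the inverse image of its unique lift to the locale of sublocales of \<open>L\<close>.
  It is meaningful when \<open>M\<close> is Boolean.
\<close>

definition lift :: "'a gorder \<Rightarrow> 'b gorder \<Rightarrow> ('a \<Rightarrow> 'b) \<Rightarrow> 'a set \<Rightarrow> 'b" where
  "lift L M f =
     (THE g. g \<in> extensional (carrier (Sl_frame L)) \<and> frame_hom (Sl_frame L) M g \<and>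
        (\<forall>u\<in>carrier L. g (can L u) = f u))"

definition opens :: "'a topology \<Rightarrow> 'a set gorder" where
  "opens X = set_order {U. openin X U}"

definition inverse_image :: "'a topology \<Rightarrow> ('a \<Rightarrow> 'b) \<Rightarrow> 'b set \<Rightarrow> 'a set" where
  "inverse_image X f V = {x \<in> topspace X. f x \<in> V}"

section \<open>Contents\<close>

text \<open>
  A content is a function on all subsets of which only the values at compact sets matter.
\<close>

definition content_on :: "'a topology \<Rightarrow> ('a set \<Rightarrow> real) \<Rightarrow> bool" where
  "content_on X l \<longleftrightarrow>
     (\<forall>C. compactin X C \<longrightarrow> 0 \<le> l C) \<and>
     (\<forall>C D. compactin X C \<and> compactin X D \<and> C \<subseteq> D \<longrightarrow> l C \<le> l D) \<and>
     (\<forall>C D. compactin X C \<and> compactin X D \<longrightarrow> l (C \<union> D) \<le> l C + l D) \<and>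
     (\<forall>C D. compactin X C \<and> compactin X D \<and> C \<inter> D = {} \<longrightarrow> l (C \<union> D) = l C + l D)"

definition way_inside :: "'a topology \<Rightarrow> 'a set \<Rightarrow> 'a set \<Rightarrow> bool" where
  "way_inside X C D \<longleftrightarrow> (\<exists>U. openin X U \<and> C \<subseteq> U \<and> U \<subseteq> D)"

text \<open>
  The infimum is taken in \<open>[0,\<infinity>]\<close>, so a compact set without compact neighbourhoods
  contradicts regularity.
\<close>

definition regular_content :: "'a topology \<Rightarrow> ('a set \<Rightarrow> real) \<Rightarrow> bool" where
  "regular_content X l \<longleftrightarrow>
     content_on X l \<and>
     (\<forall>K. compactin X K \<longrightarrow>
        ennreal (l K) = (INF K'\<in>{K'. compactin X K' \<and> way_inside X K K'}. ennreal (l K')))"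

section \<open>The locale of a content\<close>

text \<open>
  Families \<open>(K\<^sub>i)\<close> of members of \<open>U\<close> are represented by their sets of values \<open>\<C>\<close>; the condition
  depends on nothing else.
\<close>

definition content_ideal :: "'a topology \<Rightarrow> ('a set \<Rightarrow> real) \<Rightarrow> 'a set set \<Rightarrow> bool" where
  "content_ideal X l U \<longleftrightarrow>
     (\<forall>K\<in>U. compactin X K) \<and>
     (\<forall>K\<in>U. \<forall>C. compactin X C \<and> C \<subseteq> K \<longrightarrow> C \<in> U) \<and>
     (\<forall>K \<C>. compactin X K \<and> \<C> \<subseteq> U \<and> (\<forall>C\<in>\<C>. C \<subseteq> K) \<and>
        (\<forall>\<epsilon>>0. \<exists>F\<subseteq>\<C>. finite F \<and> l K - l (\<Union>F) < \<epsilon>) \<longrightarrow> K \<in> U)"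

definition content_locale :: "'a topology \<Rightarrow> ('a set \<Rightarrow> real) \<Rightarrow> 'a set set gorder" where
  "content_locale X l = set_order {U. content_ideal X l U}"

definition inner_measure :: "('a set \<Rightarrow> real) \<Rightarrow> 'a set set \<Rightarrow> ennreal" where
  "inner_measure l U = (SUP K\<in>U. ennreal (l K))"

definition content_proj :: "'a topology \<Rightarrow> ('a set \<Rightarrow> real) \<Rightarrow> 'a set \<Rightarrow> 'a set set" where
  "content_proj X l V = content_ideal X l hull {K. compactin X K \<and> K \<subseteq> V}"

definition content_proj_lift :: "'a topology \<Rightarrow> ('a set \<Rightarrow> real) \<Rightarrow> 'a set set \<Rightarrow> 'a set set" where
  "content_proj_lift X l = lift (opens X) (content_locale X l) (content_proj X l)"

definition sublocale_measure :: "'a topology \<Rightarrow> ('a set \<Rightarrow> real) \<Rightarrow> 'a set set \<Rightarrow> ennreal" where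
  "sublocale_measure X l T = inner_measure l (content_proj_lift X l T)"

section \<open>The induced measure of a subset\<close>

abbreviation disc :: "'a topology \<Rightarrow> 'a topology" where
  "disc X \<equiv> discrete_topology (topspace X)"

definition disc_lift :: "'a topology \<Rightarrow> 'a set set \<Rightarrow> 'a set" where
  "disc_lift X = lift (opens X) (opens (disc X)) (inverse_image (disc X) id)"

definition induced_measure :: "'a topology \<Rightarrow> ('a set \<Rightarrow> real) \<Rightarrow> 'a set \<Rightarrow> ennreal" where
  "induced_measure X l S =
     sublocale_measure X l
       (right_adjoint (Sl_frame (opens X)) (opens (disc X)) (disc_lift X) S)"

end

theory Submission
  imports Defs
begin

text \<open>
  Both localic constructions in the induced measure are lifts along \<open>can\<close>, and one formula computes
  them.  Write \<open>j\<close> for the nucleus of a sublocale \<open>T\<close> of \<open>L\<close>, which sends \<open>u\<close> to the least element of \<open>T\<close>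
  above it.  In the frame of sublocales, \<open>T\<close> is the supremum over \<open>u\<close> of the differences of
  \<open>can (j u)\<close> and \<open>can u\<close>.  A frame homomorphism preserves suprema and complements, so a lift of \<open>f\<close>
  must send \<open>T\<close> to the supremum of the differences of \<open>f (j u)\<close> and \<open>f u\<close>.  Conversely this formula
  defines a lift whenever the elements \<open>f u\<close> are complemented (\<open>lift_eq_explicit_lift\<close>).

  For the identity map from the discrete space to \<open>X\<close>, the formula gives the union of the sets
  \<open>j U - U\<close>.  It is contained in \<open>S\<close> iff \<open>T\<close> contains the sublocale of the subspace complementary to \<open>S\<close>,
  whose nucleus sends \<open>U\<close> to the largest open \<open>V\<close> with \<open>V - U \<subseteq> S\<close>.  So this sublocale is the value of the
  right adjoint at \<open>S\<close> (\<open>right_adjoint_disc_lift\<close>).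

  For the projection of the content locale, let \<open>I A\<close> be the content ideal generated by the compact
  subsets of a set \<open>A\<close>; on open sets this is the inverse image map.  Regularity enters
  through a splitting: for \<open>K\<close> compact and \<open>U\<close> open, the disjoint union of \<open>K - U\<close> and a suitable compact
  subset of \<open>K \<inter> U\<close> has almost the content of \<open>K\<close> (\<open>open_split\<close>).  Hence the content is modular, the ideal of
  the set complement of \<open>U\<close> is the complement of \<open>I U\<close>, and \<open>I\<close> preserves unions of open sets.  Modularity
  makes \<open>I A\<close> the set of compact \<open>K\<close> that are approximated in content by compact subsets of \<open>K \<inter> A\<close>.
  Therefore \<open>I A \<inter> I B = I (A \<inter> B)\<close>, and the inner measure of \<open>I A\<close> is the supremum of the
  contents of the compact subsets of \<open>A\<close>.

  Combining these, the sublocale belonging to \<open>S\<close> is lifted to the supremum of the ideals \<open>I (j U - U)\<close>.  All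
  sets \<open>j U - U\<close> lie in \<open>S\<close>, and every compact subset of \<open>S\<close> is of this form, so the supremum is \<open>I S\<close>
  (\<open>content_proj_lift_relative_sublocale\<close>).
\<close>

section \<open>Frames given by explicit suprema and meets\<close>

lemma (in partial_order) sup_equality:
  assumes "least L s (Upper L A)"
  shows "\<Squnion>A = s"
  unfolding sup_def using assms by (rule some_equality) (rule least_unique[OF _ assms])

lemma (in partial_order) inf_equality:
  assumes "greatest L s (Lower L A)"
  shows "\<Sqinter>A = s"
  unfolding inf_def using assms by (rule some_equality) (rule greatest_unique[OF _ assms])

lemma (in partial_order) top_equality:
  assumes "t \<in> carrier L" "\<And>x. x \<in> carrier L \<Longrightarrow> x \<sqsubseteq> t"
  shows "\<top> = t"
proof -
  have t: "greatest L t (carrier L)"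
    using assms by (simp add: greatest_def)
  then show ?thesis
    unfolding top_def by (rule some_equality) (rule greatest_unique[OF _ t])
qed

lemma (in partial_order) bottom_equality:
  assumes "b \<in> carrier L" "\<And>x. x \<in> carrier L \<Longrightarrow> b \<sqsubseteq> x"
  shows "\<bottom> = b"
proof -
  have b: "least L b (carrier L)"
    using assms by (simp add: least_def)
  then show ?thesis
    unfolding bottom_def by (rule some_equality) (rule least_unique[OF _ b])
qed

text \<open>
  The frames constructed below come with concrete suprema \<open>s\<close> and binary meets \<open>m\<close>.  Since the operations of an
  order are chosen by description, this lemma does two jobs at once: it builds the frame and identifies
  its abstract operations with the concrete ones.  Suprema suffice for completeness, because the
  infimum of a set is the supremum of its lower bounds, and only one half of the distributive law
  needs an argument.
\<close>

lemma frame_explicit: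
  fixes L (structure)
  assumes "partial_order L"
    and s_closed: "\<And>A. A \<subseteq> carrier L \<Longrightarrow> s A \<in> carrier L"
    and s_upper: "\<And>A x. \<lbrakk>A \<subseteq> carrier L; x \<in> A\<rbrakk> \<Longrightarrow> x \<sqsubseteq> s A"
    and s_least: "\<And>A z. \<lbrakk>A \<subseteq> carrier L; z \<in> carrier L; \<And>x. x \<in> A \<Longrightarrow> x \<sqsubseteq> z\<rbrakk> \<Longrightarrow> s A \<sqsubseteq> z"
    and m_closed: "\<And>x y. \<lbrakk>x \<in> carrier L; y \<in> carrier L\<rbrakk> \<Longrightarrow> m x y \<in> carrier L"
    and m_left: "\<And>x y. \<lbrakk>x \<in> carrier L; y \<in> carrier L\<rbrakk> \<Longrightarrow> m x y \<sqsubseteq> x"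
    and m_right: "\<And>x y. \<lbrakk>x \<in> carrier L; y \<in> carrier L\<rbrakk> \<Longrightarrow> m x y \<sqsubseteq> y"
    and m_greatest: "\<And>x y z. \<lbrakk>x \<in> carrier L; y \<in> carrier L; z \<in> carrier L; z \<sqsubseteq> x; z \<sqsubseteq> y\<rbrakk> \<Longrightarrow> z \<sqsubseteq> m x y"
    and distrib: "\<And>v A. \<lbrakk>v \<in> carrier L; A \<subseteq> carrier L\<rbrakk> \<Longrightarrow> m v (s A) \<sqsubseteq> s (m v ` A)"
  shows "frame L" and "A \<subseteq> carrier L \<Longrightarrow> \<Squnion>A = s A"
    and "\<lbrakk>x \<in> carrier L; y \<in> carrier L\<rbrakk> \<Longrightarrow> x \<sqinter> y = m x y"
proof -
  interpret partial_order L by fact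
  have lub: "least L (s A) (Upper L A)" if "A \<subseteq> carrier L" for A
  proof (rule least_UpperI)
    show "s A \<sqsubseteq> y" if "y \<in> Upper L A" for y
      using that \<open>A \<subseteq> carrier L\<close> by (intro s_least) (auto simp: Upper_def)
  qed (use that s_closed s_upper in auto)
  have glb: "greatest L (s (Lower L A)) (Lower L A)" if A: "A \<subseteq> carrier L" for A
  proof (rule greatest_LowerI)
    fix x assume "x \<in> A"
    then show "s (Lower L A) \<sqsubseteq> x"
      using A by (intro s_least) auto
  next
    show "y \<sqsubseteq> s (Lower L A)" if "y \<in> Lower L A" for y
      using that by (intro s_upper) auto
  qed (use A s_closed in auto)
  have sup: "\<Squnion>A = s A" if "A \<subseteq> carrier L" for A
    using lub[OF that] by (rule sup_equality)
  have meet: "x \<sqinter> y = m x y" if "x \<in> carrier L" "y \<in> carrier L" for x y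
    unfolding meet_def
    by (rule inf_equality, rule greatest_LowerI)
      (use that m_closed m_left m_right m_greatest in \<open>auto simp: Lower_def\<close>)
  interpret complete_lattice L
    by standard (use lub glb in blast)+
  show "frame L"
  proof
    fix v A assume v: "v \<in> carrier L" and A: "A \<subseteq> carrier L"
    have "(\<lambda>u. v \<sqinter> u) ` A = m v ` A"
      using v A meet by (intro image_cong) auto
    moreover have mA: "m v ` A \<subseteq> carrier L"
      using v A m_closed by auto
    moreover have "m v (s A) = s (m v ` A)"
    proof (rule le_antisym)
      show "s (m v ` A) \<sqsubseteq> m v (s A)"
      proof (rule s_least[OF mA])
        fix x assume "x \<in> m v ` A"
        then obtain u where u: "u \<in> A" "x = m v u" by blast
        then have uL: "u \<in> carrier L" using A by blast
        show "x \<sqsubseteq> m v (s A)"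
          unfolding u(2)
          using v uL A u(1) m_closed m_left m_right s_closed s_upper
          by (intro m_greatest) (auto intro: le_trans[OF m_right])
      qed (use v A m_closed s_closed in auto)
    qed (use v A mA distrib m_closed s_closed in auto)
    ultimately show "v \<sqinter> \<Squnion>A = \<Squnion>((\<lambda>u. v \<sqinter> u) ` A)"
      using v A meet sup s_closed by simp
  qed
  show "A \<subseteq> carrier L \<Longrightarrow> \<Squnion>A = s A" by (rule sup)
  show "\<lbrakk>x \<in> carrier L; y \<in> carrier L\<rbrakk> \<Longrightarrow> x \<sqinter> y = m x y" by (rule meet)
qed

section \<open>Sublocales and nuclei\<close>

context frame
begin

lemma le_meet_iff:
  "\<lbrakk>x \<in> carrier L; y \<in> carrier L; z \<in> carrier L\<rbrakk> \<Longrightarrow> z \<sqsubseteq> x \<sqinter> y \<longleftrightarrow> z \<sqsubseteq> x \<and> z \<sqsubseteq> y"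
  by (meson le_trans meet_closed meet_le meet_left meet_right)

lemma join_le_iff:
  "\<lbrakk>x \<in> carrier L; y \<in> carrier L; z \<in> carrier L\<rbrakk> \<Longrightarrow> x \<squnion> y \<sqsubseteq> z \<longleftrightarrow> x \<sqsubseteq> z \<and> y \<sqsubseteq> z"
  by (meson le_trans join_closed join_le join_left join_right)

lemma sup_le_iff:
  "\<lbrakk>A \<subseteq> carrier L; z \<in> carrier L\<rbrakk> \<Longrightarrow> \<Squnion>A \<sqsubseteq> z \<longleftrightarrow> (\<forall>x\<in>A. x \<sqsubseteq> z)"
  by (meson le_trans subsetD sup_closed sup_least sup_upper)

lemma le_inf_iff:
  "\<lbrakk>A \<subseteq> carrier L; z \<in> carrier L\<rbrakk> \<Longrightarrow> z \<sqsubseteq> \<Sqinter>A \<longleftrightarrow> (\<forall>x\<in>A. z \<sqsubseteq> x)"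
  by (meson le_trans subsetD inf_closed inf_greatest inf_lower)

lemma meet_join_distrib:
  assumes "x \<in> carrier L" "y \<in> carrier L" "z \<in> carrier L"
  shows "x \<sqinter> (y \<squnion> z) = (x \<sqinter> y) \<squnion> (x \<sqinter> z)"
  using meet_Sup_distrib[of x "{y, z}"] assms by (simp add: join_def)

text \<open>
  The Heyting implication, which exists in every frame.
\<close>

definition imp :: "'a \<Rightarrow> 'a \<Rightarrow> 'a" where
  "imp a b = \<Squnion>{c \<in> carrier L. c \<sqinter> a \<sqsubseteq> b}"

lemma imp_closed [simp]: "imp a b \<in> carrier L"
  unfolding imp_def by (intro sup_closed) blast

lemma le_imp_iff:
  assumes "a \<in> carrier L" "b \<in> carrier L" "c \<in> carrier L"
  shows "c \<sqsubseteq> imp a b \<longleftrightarrow> c \<sqinter> a \<sqsubseteq> b"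
proof
  assume c: "c \<sqsubseteq> imp a b"
  have "a \<sqinter> imp a b \<sqsubseteq> b"
    unfolding imp_def using assms
    by (subst meet_Sup_distrib) (auto intro!: sup_least simp: meet_comm[of L a])
  moreover have "c \<sqinter> a \<sqsubseteq> a \<sqinter> imp a b"
    using assms c by (auto simp: le_meet_iff meet_right intro: le_trans[OF meet_left])
  ultimately show "c \<sqinter> a \<sqsubseteq> b"
    using assms by (meson imp_closed le_trans meet_closed)
next
  assume "c \<sqinter> a \<sqsubseteq> b"
  then show "c \<sqsubseteq> imp a b"
    unfolding imp_def using assms by (intro sup_upper) auto
qed

text \<open>
  The elementary description of sublocales: subsets closed under infima and under implications into
  them.  Unlike the definition through a left adjoint, it is visibly stable under intersections.
\<close>

definition sublocale_set :: "'a set \<Rightarrow> bool" where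
  "sublocale_set S \<longleftrightarrow> S \<subseteq> carrier L \<and> (\<forall>A\<subseteq>S. \<Sqinter>A \<in> S) \<and> (\<forall>a\<in>carrier L. \<forall>s\<in>S. imp a s \<in> S)"

text \<open>
  The least element of \<open>S\<close> above \<open>a\<close>; for a sublocale this is the left adjoint of the inclusion.
\<close>

definition nucleus :: "'a set \<Rightarrow> 'a \<Rightarrow> 'a" where
  "nucleus S a = \<Sqinter>{s \<in> S. a \<sqsubseteq> s}"

lemma
  assumes "sublocale_set S"
  shows sublocale_set_subset: "S \<subseteq> carrier L"
    and sublocale_set_inf: "A \<subseteq> S \<Longrightarrow> \<Sqinter>A \<in> S"
    and sublocale_set_imp: "\<lbrakk>a \<in> carrier L; s \<in> S\<rbrakk> \<Longrightarrow> imp a s \<in> S"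
    and nucleus_mem: "nucleus S a \<in> S"
  using assms unfolding sublocale_set_def nucleus_def by auto

lemma nucleus_le_iff:
  assumes "S \<subseteq> carrier L" "a \<in> carrier L" "s \<in> S"
  shows "nucleus S a \<sqsubseteq> s \<longleftrightarrow> a \<sqsubseteq> s"
proof
  have *: "a \<sqsubseteq> nucleus S a"
    unfolding nucleus_def using assms by (intro inf_greatest) auto
  have N: "nucleus S a \<in> carrier L"
    unfolding nucleus_def using assms by (intro inf_closed) auto
  show "nucleus S a \<sqsubseteq> s \<Longrightarrow> a \<sqsubseteq> s"
    using le_trans[OF *] assms N by blast
  show "a \<sqsubseteq> s \<Longrightarrow> nucleus S a \<sqsubseteq> s"
    unfolding nucleus_def using assms by (intro inf_lower) auto
qed

lemma nucleus_closed [simp]: "S \<subseteq> carrier L \<Longrightarrow> nucleus S a \<in> carrier L"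
  unfolding nucleus_def by (intro inf_closed) auto

lemma le_nucleus: "\<lbrakk>S \<subseteq> carrier L; a \<in> carrier L\<rbrakk> \<Longrightarrow> a \<sqsubseteq> nucleus S a"
  unfolding nucleus_def by (intro inf_greatest) auto

text \<open>
  Closure under implication is what makes the closure operator of \<open>S\<close> preserve binary meets: an upper
  bound \<open>s \<in> S\<close> of \<open>a \<sqinter> b\<close> gives \<open>imp b s \<in> S\<close> above \<open>a\<close>, so \<open>a\<close> may be replaced by its closure, and
  then \<open>b\<close> likewise.
\<close>

lemma nucleus_meet:
  assumes S: "sublocale_set S" and ab: "a \<in> carrier L" "b \<in> carrier L"
  shows "nucleus S a \<sqinter> nucleus S b = nucleus S (a \<sqinter> b)"
proof -
  note SL = sublocale_set_subset[OF S]
  let ?j = "nucleus S"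
  have j: "?j x \<in> carrier L" "?j x \<in> S" for x
    using S SL by (auto intro: nucleus_mem)
  show ?thesis
  proof (rule le_antisym)
    show "?j (a \<sqinter> b) \<sqsubseteq> ?j a \<sqinter> ?j b"
      using ab SL j
      by (auto simp: le_meet_iff nucleus_le_iff intro: le_trans[OF meet_left] le_trans[OF meet_right] le_nucleus)
    have "a \<sqinter> b \<sqsubseteq> ?j (a \<sqinter> b)"
      using SL ab by (simp add: le_nucleus)
    then have "a \<sqsubseteq> imp b (?j (a \<sqinter> b))"
      using ab j by (simp add: le_imp_iff)
    then have "?j a \<sqsubseteq> imp b (?j (a \<sqinter> b))"
      using ab j SL S by (simp add: nucleus_le_iff sublocale_set_imp)
    then have "b \<sqsubseteq> imp (?j a) (?j (a \<sqinter> b))"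
      using ab j by (simp add: le_imp_iff meet_comm)
    then have "?j b \<sqsubseteq> imp (?j a) (?j (a \<sqinter> b))"
      using ab j SL S by (simp add: nucleus_le_iff sublocale_set_imp)
    then show "?j a \<sqinter> ?j b \<sqsubseteq> ?j (a \<sqinter> b)"
      using ab j by (simp add: le_imp_iff meet_comm)
  qed (use j ab SL in auto)
qed

end

text \<open>
  The constants for frame homomorphisms and sublocales live on plain order records, so the ambient
  frame is fixed at that type here.
\<close>

locale ambient_frame = frame L for L :: "'a gorder" (structure)
begin

lemma frame_sublocale_set:
  assumes S: "sublocale_set S"
  shows "frame (L\<lparr>carrier := S\<rparr>)"
    and "A \<subseteq> S \<Longrightarrow> \<Squnion>\<^bsub>L\<lparr>carrier := S\<rparr>\<^esub>A = nucleus S (\<Squnion>A)"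
    and "\<lbrakk>x \<in> S; y \<in> S\<rbrakk> \<Longrightarrow> x \<sqinter>\<^bsub>L\<lparr>carrier := S\<rparr>\<^esub> y = x \<sqinter> y"
proof -
  let ?M = "L\<lparr>carrier := S\<rparr>"
  note SL = sublocale_set_subset[OF S]
  have fixed: "nucleus S s = s" if "s \<in> S" for s
    using that subsetD[OF SL that] by (intro le_antisym) (simp_all add: nucleus_le_iff[OF SL] le_nucleus[OF SL] SL)
  have po: "partial_order ?M"
    using SL eq_is_equal by unfold_locales (auto intro: le_trans)
  have 1: "\<And>A. A \<subseteq> carrier ?M \<Longrightarrow> nucleus S (\<Squnion>A) \<in> carrier ?M"
    using S by (simp add: nucleus_mem)
  have 2: "\<And>A x. \<lbrakk>A \<subseteq> carrier ?M; x \<in> A\<rbrakk> \<Longrightarrow> x \<sqsubseteq>\<^bsub>?M\<^esub> nucleus S (\<Squnion>A)"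
    using S SL by simp (meson le_nucleus le_trans nucleus_closed order_trans subsetD sup_closed sup_upper)
  have 3: "\<And>A z. \<lbrakk>A \<subseteq> carrier ?M; z \<in> carrier ?M; \<And>x. x \<in> A \<Longrightarrow> x \<sqsubseteq>\<^bsub>?M\<^esub> z\<rbrakk>
      \<Longrightarrow> nucleus S (\<Squnion>A) \<sqsubseteq>\<^bsub>?M\<^esub> z"
    using SL by (simp add: nucleus_le_iff subset_trans[OF _ SL] subsetD[OF SL] sup_le_iff)
  have 4: "x \<sqinter> y \<in> carrier ?M" if "x \<in> carrier ?M" "y \<in> carrier ?M" for x y
    using that S sublocale_set_inf[OF S, of "{x, y}"] by (simp add: meet_def)
  have 5: "nucleus S (\<Squnion>((\<lambda>u. v \<sqinter> u) ` A)) = v \<sqinter> nucleus S (\<Squnion>A)"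
    if "v \<in> carrier ?M" "A \<subseteq> carrier ?M" for v A
  proof -
    have "A \<subseteq> carrier L" "v \<in> carrier L" "v \<in> S"
      using that SL by auto
    then show ?thesis
      using nucleus_meet[OF S, of v "\<Squnion>A"] by (simp add: meet_Sup_distrib fixed)
  qed
  have 6: "v \<sqinter> nucleus S (\<Squnion>A) \<sqsubseteq>\<^bsub>?M\<^esub> nucleus S (\<Squnion>((\<lambda>u. v \<sqinter> u) ` A))"
    if "v \<in> carrier ?M" "A \<subseteq> carrier ?M" for v A
    using that SL by (subst 5) (auto simp: subsetD[OF SL])
  have 7: "\<And>x y. \<lbrakk>x \<in> carrier ?M; y \<in> carrier ?M\<rbrakk> \<Longrightarrow> x \<sqinter> y \<sqsubseteq>\<^bsub>?M\<^esub> x"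
    "\<And>x y. \<lbrakk>x \<in> carrier ?M; y \<in> carrier ?M\<rbrakk> \<Longrightarrow> x \<sqinter> y \<sqsubseteq>\<^bsub>?M\<^esub> y"
    "\<And>x y z. \<lbrakk>x \<in> carrier ?M; y \<in> carrier ?M; z \<in> carrier ?M; z \<sqsubseteq>\<^bsub>?M\<^esub> x; z \<sqsubseteq>\<^bsub>?M\<^esub> y\<rbrakk>
      \<Longrightarrow> z \<sqsubseteq>\<^bsub>?M\<^esub> x \<sqinter> y"
    using SL by (auto simp: le_meet_iff subsetD[OF SL] intro: meet_left meet_right)
  note * = frame_explicit[OF po 1 2 3 4 7 6]
  show "frame ?M"
    by (rule *(1))
  show "A \<subseteq> S \<Longrightarrow> \<Squnion>\<^bsub>?M\<^esub>A = nucleus S (\<Squnion>A)"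
    using *(2) by simp
  show "\<lbrakk>x \<in> S; y \<in> S\<rbrakk> \<Longrightarrow> x \<sqinter>\<^bsub>?M\<^esub> y = x \<sqinter> y"
    using *(3) by simp
qed

lemma frame_hom_nucleus:
  assumes S: "sublocale_set S"
  shows "frame_hom L (L\<lparr>carrier := S\<rparr>) (nucleus S)"
proof -
  let ?M = "L\<lparr>carrier := S\<rparr>"
  note SL = sublocale_set_subset[OF S]
  note M = frame_sublocale_set[OF S]
  interpret M: frame ?M by (rule M(1))
  have nS: "nucleus S x \<in> S" for x
    using S by (rule nucleus_mem)
  have "nucleus S (\<Squnion>A) = \<Squnion>\<^bsub>?M\<^esub>(nucleus S ` A)" if A: "A \<subseteq> carrier L" for A
  proof -
    have nA: "nucleus S ` A \<subseteq> S" "nucleus S ` A \<subseteq> carrier L"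
      using nS SL by auto
    have "nucleus S (\<Squnion>A) = nucleus S (\<Squnion>(nucleus S ` A))"
    proof (rule le_antisym)
      have le: "x \<sqsubseteq> nucleus S (\<Squnion>(nucleus S ` A))" if "x \<in> A" for x
      proof -
        have "nucleus S x \<sqsubseteq> nucleus S (\<Squnion>(nucleus S ` A))"
          using that nA SL by (meson image_eqI le_nucleus le_trans nucleus_closed subsetD sup_closed sup_upper)
        then show ?thesis
          using that A SL nS by (auto simp: nucleus_le_iff)
      qed
      show "nucleus S (\<Squnion>A) \<sqsubseteq> nucleus S (\<Squnion>(nucleus S ` A))"
        using A SL nS le by (simp add: nucleus_le_iff sup_le_iff)
      have "x \<sqsubseteq> nucleus S (\<Squnion>A)" if "x \<in> A" for x
        using that A SL by (meson le_nucleus le_trans nucleus_closed subsetD sup_closed sup_upper)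
      then show "nucleus S (\<Squnion>(nucleus S ` A)) \<sqsubseteq> nucleus S (\<Squnion>A)"
        using A SL nS nA by (auto simp: nucleus_le_iff sup_le_iff)
    qed (use SL in auto)
    then show ?thesis
      using M(2)[OF nA(1)] by simp
  qed
  moreover have "nucleus S \<top> = \<top>\<^bsub>?M\<^esub>"
  proof (rule M.top_equality[symmetric])
    show "x \<sqsubseteq>\<^bsub>?M\<^esub> nucleus S \<top>" if "x \<in> carrier ?M" for x
      using that SL le_nucleus[OF SL, of \<top>] by simp (meson le_trans nucleus_closed subsetD top_closed top_higher)
  qed (use nS in auto)
  ultimately show ?thesis
    unfolding frame_hom_def using M nS nucleus_meet[OF S] by (auto simp: frame_axioms)
qed

text \<open>
  For the direction from left to right, let \<open>h\<close> be the left adjoint of the inclusion.  An element of the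
  frame lies in \<open>S\<close> as soon as \<open>h a \<sqsubseteq> a\<close>.  For an infimum of elements of \<open>S\<close> this is adjointness; for an
  implication \<open>imp a s\<close> it follows because \<open>h\<close> preserves binary meets.
\<close>

lemma is_sublocale_iff: "is_sublocale L S \<longleftrightarrow> sublocale_set S"
proof
  let ?M = "L\<lparr>carrier := S\<rparr>"
  assume S: "sublocale_set S"
  note SL = sublocale_set_subset[OF S]
  interpret M: frame ?M by (rule frame_sublocale_set(1)[OF S])
  have "galois_connection \<lparr>orderA = L, orderB = ?M, lower = nucleus S, upper = \<lambda>x. x\<rparr>"
    using SL S by (intro galois_connection.intro connection.intro galois_connection_axioms.intro)
      (auto simp: nucleus_le_iff nucleus_mem partial_order_axioms M.partial_order_axioms)
  then show "is_sublocale L S"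
    unfolding is_sublocale_def using SL frame_hom_nucleus[OF S] M.frame_axioms by blast
next
  let ?M = "L\<lparr>carrier := S\<rparr>"
  assume S: "is_sublocale L S"
  then have SL: "S \<subseteq> carrier L" and "frame ?M"
    unfolding is_sublocale_def by auto
  obtain h where hom: "frame_hom L ?M h"
    and gal: "galois_connection \<lparr>orderA = L, orderB = ?M, lower = h, upper = \<lambda>x. x\<rparr>"
    using S unfolding is_sublocale_def by auto
  interpret M: frame ?M by fact
  have hS: "h a \<in> S" if "a \<in> carrier L" for a
    using hom that by (auto simp: frame_hom_def)
  have hL: "h a \<in> carrier L" if "a \<in> carrier L" for a
    using hS[OF that] SL by blast
  have h_iff: "h a \<sqsubseteq> s \<longleftrightarrow> a \<sqsubseteq> s" if "a \<in> carrier L" "s \<in> S" for a s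
    using galois_connection.galois_property[OF gal, of a s] that by simp
  have fixed: "a \<in> S" if "a \<in> carrier L" "h a \<sqsubseteq> a" for a
    using that h_iff[of a "h a"] hS[of a] hL[of a] le_antisym[of a "h a"] by auto
  have inf: "\<Sqinter>A \<in> S" if "A \<subseteq> S" for A
  proof -
    have A: "A \<subseteq> carrier L" using that SL by blast
    have "h (\<Sqinter>A) \<sqsubseteq> \<Sqinter>A"
    proof (rule inf_greatest[OF A])
      show "h (\<Sqinter>A) \<sqsubseteq> x" if "x \<in> A" for x
        using that \<open>A \<subseteq> S\<close> A by (subst h_iff) (auto intro: inf_lower)
    qed (use A hL in auto)
    then show ?thesis using fixed A by simp
  qed
  have "imp a s \<in> S" if a: "a \<in> carrier L" and s: "s \<in> S" for a s
  proof (rule fixed)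
    let ?c = "imp a s"
    have sL: "s \<in> carrier L" using s SL by blast
    have m: "h ?c \<sqinter> h a \<in> S"
      using inf[of "{h ?c, h a}"] a hS by (auto simp: meet_def)
    have "h ?c \<sqinter> a \<sqsubseteq> h ?c \<sqinter> h a"
      using a hL hS h_iff[of a "h a"] by (auto simp: le_meet_iff meet_left intro: le_trans[OF meet_right])
    also have "h ?c \<sqinter> h a \<sqsubseteq>\<^bsub>?M\<^esub> h ?c \<sqinter>\<^bsub>?M\<^esub> h a"
      using a m hS hL by (subst M.le_meet_iff) (auto intro: meet_left meet_right)
    then have "h ?c \<sqinter> h a \<sqsubseteq> h (?c \<sqinter> a)"
      using hom a by (simp add: frame_hom_def)
    also have "h (?c \<sqinter> a) \<sqsubseteq> s"
      using a s sL by (simp add: h_iff le_imp_iff[symmetric])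
    finally have "h ?c \<sqinter> a \<sqsubseteq> s"
      using a hL sL by simp
    then show "h ?c \<sqsubseteq> ?c"
      using a sL hL by (simp add: le_imp_iff)
  qed simp
  then show "sublocale_set S"
    unfolding sublocale_set_def using SL inf by blast
qed

end

section \<open>The coframe of sublocales\<close>

context frame
begin

lemma meet_mono:
  assumes "a \<sqsubseteq> c" "b \<sqsubseteq> d" "a \<in> carrier L" "b \<in> carrier L" "c \<in> carrier L" "d \<in> carrier L"
  shows "a \<sqinter> b \<sqsubseteq> c \<sqinter> d"
proof (rule meet_le)
  show "a \<sqinter> b \<sqsubseteq> c"
    using assms by (intro le_trans[OF meet_left]) auto
  show "a \<sqinter> b \<sqsubseteq> d"
    using assms by (intro le_trans[OF meet_right]) auto
qed (use assms in auto)

lemma nucleus_mono: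
  assumes "sublocale_set S" "a \<in> carrier L" "b \<in> carrier L" "a \<sqsubseteq> b"
  shows "nucleus S a \<sqsubseteq> nucleus S b"
  using assms sublocale_set_subset[OF assms(1)]
  by (meson le_nucleus le_trans nucleus_closed nucleus_le_iff nucleus_mem)

lemma sublocale_set_memI:
  assumes "sublocale_set S" "a \<in> carrier L" "nucleus S a \<sqsubseteq> a"
  shows "a \<in> S"
  using assms nucleus_mem[of S a] le_antisym[of a "nucleus S a"] le_nucleus[of S a]
    sublocale_set_subset[OF assms(1)] by auto

lemma nucleus_le:
  assumes "sublocale_set S" "a \<in> S"
  shows "nucleus S a \<sqsubseteq> a"
  using assms sublocale_set_subset[OF assms(1)] by (auto simp: nucleus_le_iff subset_iff)

lemma sublocale_set_carrier: "sublocale_set (carrier L)"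
  by (simp add: sublocale_set_def)

lemma sublocale_set_Inter:
  assumes "\<And>S. S \<in> \<S> \<Longrightarrow> sublocale_set S"
  shows "sublocale_set (\<Inter>\<S> \<inter> carrier L)"
  unfolding sublocale_set_def
proof (intro conjI allI impI ballI)
  show "\<Sqinter>A \<in> \<Inter>\<S> \<inter> carrier L" if "A \<subseteq> \<Inter>\<S> \<inter> carrier L" for A
  proof -
    have "\<Sqinter>A \<in> S" if "S \<in> \<S>" for S
      using that \<open>A \<subseteq> _\<close> by (intro sublocale_set_inf assms) auto
    then show ?thesis
      using that by simp
  qed
qed (use sublocale_set_imp[OF assms] in auto)

text \<open>
  The smallest sublocale containing \<open>S\<close> and \<open>T\<close>: it consists of the elements that are a meet of an
  element of \<open>S\<close> and one of \<open>T\<close>, the nuclei giving the best candidates for the two factors.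
\<close>

definition sublocale_join :: "'a set \<Rightarrow> 'a set \<Rightarrow> 'a set" where
  "sublocale_join S T = {x \<in> carrier L. nucleus S x \<sqinter> nucleus T x \<sqsubseteq> x}"

lemma sublocale_set_join:
  assumes S: "sublocale_set S" and T: "sublocale_set T"
  shows "sublocale_set (sublocale_join S T)"
  unfolding sublocale_set_def
proof (intro conjI allI impI ballI)
  note SL = sublocale_set_subset[OF S] and TL = sublocale_set_subset[OF T]
  show "sublocale_join S T \<subseteq> carrier L"
    by (auto simp: sublocale_join_def)
  show "\<Sqinter>A \<in> sublocale_join S T" if A: "A \<subseteq> sublocale_join S T" for A
  proof -
    have AL: "A \<subseteq> carrier L" using A by (auto simp: sublocale_join_def)
    have "nucleus S (\<Sqinter>A) \<sqinter> nucleus T (\<Sqinter>A) \<sqsubseteq> x" if "x \<in> A" for x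
    proof -
      have x: "x \<in> carrier L" "nucleus S x \<sqinter> nucleus T x \<sqsubseteq> x"
        using A that by (auto simp: sublocale_join_def)
      have "nucleus S (\<Sqinter>A) \<sqsubseteq> nucleus S x" "nucleus T (\<Sqinter>A) \<sqsubseteq> nucleus T x"
        using AL that x by (auto intro!: nucleus_mono S T inf_lower)
      then have "nucleus S (\<Sqinter>A) \<sqinter> nucleus T (\<Sqinter>A) \<sqsubseteq> nucleus S x \<sqinter> nucleus T x"
        using SL TL by (intro meet_mono) auto
      from le_trans[OF this x(2)] show ?thesis
        using x SL TL by simp
    qed
    then show ?thesis
      using AL SL TL by (simp add: sublocale_join_def le_inf_iff)
  qed
  show "imp a x \<in> sublocale_join S T" if a: "a \<in> carrier L" and x: "x \<in> sublocale_join S T" for a x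
  proof -
    let ?c = "imp a x"
    have xL: "x \<in> carrier L" and x': "nucleus S x \<sqinter> nucleus T x \<sqsubseteq> x"
      using x by (auto simp: sublocale_join_def)
    have ca: "?c \<sqinter> a \<sqsubseteq> x"
      using a xL by (simp add: le_imp_iff[symmetric])
    have le: "nucleus R ?c \<sqinter> a \<sqsubseteq> nucleus R x" if R: "sublocale_set R" for R
    proof -
      note RL = sublocale_set_subset[OF R]
      have "nucleus R ?c \<sqinter> a \<sqsubseteq> nucleus R ?c \<sqinter> nucleus R a"
        using a RL by (intro meet_mono) (auto simp: le_nucleus)
      also have "\<dots> = nucleus R (?c \<sqinter> a)"
        using a by (simp add: nucleus_meet R)
      also have "\<dots> \<sqsubseteq> nucleus R x"
        using a xL ca by (intro nucleus_mono R) auto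
      finally show ?thesis
        using a RL by simp
    qed
    let ?y = "(nucleus S ?c \<sqinter> nucleus T ?c) \<sqinter> a"
    have y: "?y \<in> carrier L"
      using a SL TL by simp
    have "?y \<sqsubseteq> nucleus S ?c \<sqinter> a" "?y \<sqsubseteq> nucleus T ?c \<sqinter> a"
      using a SL TL by (auto intro!: meet_mono meet_left meet_right)
    then have "?y \<sqsubseteq> nucleus S x" "?y \<sqsubseteq> nucleus T x"
      using le_trans[OF _ le[OF S] y] le_trans[OF _ le[OF T] y] a SL TL by simp_all
    then have "?y \<sqsubseteq> nucleus S x \<sqinter> nucleus T x"
      using y SL TL by (simp add: le_meet_iff)
    then have "?y \<sqsubseteq> x"
      using le_trans[OF _ x' y] xL SL TL by simp
    then show ?thesis
      using a xL SL TL by (simp add: sublocale_join_def le_imp_iff)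
  qed
qed

lemma sublocale_join_upper:
  assumes S: "sublocale_set S" and T: "sublocale_set T"
  shows "S \<subseteq> sublocale_join S T" "T \<subseteq> sublocale_join S T"
proof -
  have *: "R \<subseteq> sublocale_join S T" if "R = S \<or> R = T" for R
  proof
    fix x assume x: "x \<in> R"
    have "nucleus R x \<sqsubseteq> x" "x \<in> carrier L"
      using that x S T nucleus_le sublocale_set_subset by blast+
    then show "x \<in> sublocale_join S T"
      using that sublocale_set_subset[OF S] sublocale_set_subset[OF T]
      by (auto simp: sublocale_join_def intro: le_trans[OF meet_left] le_trans[OF meet_right])
  qed
  show "S \<subseteq> sublocale_join S T" "T \<subseteq> sublocale_join S T"
    by (simp_all add: *)
qed

lemma sublocale_join_least:
  assumes S: "sublocale_set S" and T: "sublocale_set T" and R: "sublocale_set R"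
    and "S \<subseteq> R" "T \<subseteq> R"
  shows "sublocale_join S T \<subseteq> R"
proof
  fix x assume "x \<in> sublocale_join S T"
  then have x: "x \<in> carrier L" "nucleus S x \<sqinter> nucleus T x \<sqsubseteq> x"
    by (auto simp: sublocale_join_def)
  have "{nucleus S x, nucleus T x} \<subseteq> R"
    using assms nucleus_mem by blast
  then have "nucleus S x \<sqinter> nucleus T x \<in> R"
    unfolding meet_def by (rule sublocale_set_inf[OF R])
  moreover have "x \<sqsubseteq> nucleus S x \<sqinter> nucleus T x"
    using x S T by (auto simp: le_meet_iff le_nucleus sublocale_set_subset)
  ultimately show "x \<in> R"
    using x sublocale_set_subset[OF R] le_antisym[of x "nucleus S x \<sqinter> nucleus T x"] by auto
qed

text \<open>
  The coframe law.  If \<open>x = s \<sqinter> t\<close> holds for \<open>s = nucleus S x\<close> and some \<open>t \<in> T\<close>, then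
  \<open>imp s x = imp s t\<close> is again in \<open>T\<close>.  The left-hand side is the same for all \<open>T\<close>, so it lies in their
  intersection, and \<open>x = s \<sqinter> imp s x\<close>.
\<close>

lemma sublocale_join_Inter:
  assumes S: "sublocale_set S" and \<T>: "\<And>T. T \<in> \<T> \<Longrightarrow> sublocale_set T"
  shows "\<Inter>(sublocale_join S ` \<T>) \<inter> carrier L \<subseteq> sublocale_join S (\<Inter>\<T> \<inter> carrier L)"
proof
  fix x assume x: "x \<in> \<Inter>(sublocale_join S ` \<T>) \<inter> carrier L"
  then have xL: "x \<in> carrier L" by simp
  note SL = sublocale_set_subset[OF S]
  let ?s = "nucleus S x"
  have s: "?s \<in> carrier L" using SL by simp
  have "imp ?s x \<in> T" if T: "T \<in> \<T>" for T
  proof -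
    note T' = \<T>[OF T] and TL = sublocale_set_subset[OF \<T>[OF T]]
    have le: "?s \<sqinter> nucleus T x \<sqsubseteq> x"
      using x T by (auto simp: sublocale_join_def)
    have "imp ?s (nucleus T x) \<sqinter> ?s \<sqsubseteq> nucleus T x"
      using s TL by (simp add: le_imp_iff[symmetric])
    then have "imp ?s (nucleus T x) \<sqinter> ?s \<sqsubseteq> ?s \<sqinter> nucleus T x"
      using s TL by (simp add: le_meet_iff meet_right)
    then have "imp ?s (nucleus T x) \<sqinter> ?s \<sqsubseteq> x"
      using le s xL TL by (meson imp_closed le_trans meet_closed nucleus_closed)
    then have "imp ?s (nucleus T x) \<sqsubseteq> imp ?s x"
      using s xL by (simp add: le_imp_iff)
    moreover have "imp ?s x \<sqinter> ?s \<sqsubseteq> nucleus T x"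
      using s xL TL le_nucleus[OF TL xL] le_imp_iff[of ?s x "imp ?s x"]
      by (meson imp_closed le_refl le_trans meet_closed nucleus_closed)
    then have "imp ?s x \<sqsubseteq> imp ?s (nucleus T x)"
      using s TL by (simp add: le_imp_iff)
    ultimately have "imp ?s x = imp ?s (nucleus T x)"
      by (intro le_antisym) auto
    then show ?thesis
      using sublocale_set_imp[OF T' s nucleus_mem[OF T']] by simp
  qed
  then have c: "imp ?s x \<in> \<Inter>\<T> \<inter> carrier L" by simp
  have "x \<sqsubseteq> imp ?s x"
    using s xL by (simp add: le_imp_iff meet_left)
  then have "nucleus (\<Inter>\<T> \<inter> carrier L) x \<sqsubseteq> imp ?s x"
    using nucleus_le_iff[OF _ xL c] by simp
  then show "x \<in> sublocale_join S (\<Inter>\<T> \<inter> carrier L)"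
    using s xL by (simp add: sublocale_join_def le_imp_iff meet_comm)
qed

lemma imp_meet_le: "\<lbrakk>u \<in> carrier L; v \<in> carrier L\<rbrakk> \<Longrightarrow> imp u v \<sqinter> u \<sqsubseteq> v"
  by (simp add: le_imp_iff[symmetric])

lemma imp_mono:
  assumes "u \<in> carrier L" "v \<in> carrier L" "w \<in> carrier L" "v \<sqsubseteq> w"
  shows "imp u v \<sqsubseteq> imp u w"
  using assms imp_meet_le[of u v] by (simp add: le_imp_iff) (meson imp_closed le_trans meet_closed)

lemma imp_imp:
  assumes "a \<in> carrier L" "b \<in> carrier L" "v \<in> carrier L"
  shows "imp a (imp b v) = imp (a \<sqinter> b) v"
proof (rule le_antisym)
  have *: "x \<sqsubseteq> imp a (imp b v) \<longleftrightarrow> x \<sqsubseteq> imp (a \<sqinter> b) v" if "x \<in> carrier L" for x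
    using assms that by (simp add: le_imp_iff meet_assoc)
  show "imp a (imp b v) \<sqsubseteq> imp (a \<sqinter> b) v" using *[of "imp a (imp b v)"] by simp
  show "imp (a \<sqinter> b) v \<sqsubseteq> imp a (imp b v)" using *[of "imp (a \<sqinter> b) v"] by simp
qed auto

end

context ambient_frame
begin

text \<open>
  The complement of the closed sublocale \<open>can L u\<close>: the elements of the form \<open>imp u v\<close>.
\<close>

definition open_sublocale :: "'a \<Rightarrow> 'a set" where
  "open_sublocale u = {v \<in> carrier L. imp u v \<sqsubseteq> v}"

lemma sublocale_set_can:
  assumes "u \<in> carrier L"
  shows "sublocale_set (can L u)"
  unfolding sublocale_set_def can_def
proof (intro conjI allI impI ballI)
  show "\<Sqinter>A \<in> {v \<in> carrier L. u \<sqsubseteq> v}" if "A \<subseteq> {v \<in> carrier L. u \<sqsubseteq> v}" for A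
  proof -
    have "A \<subseteq> carrier L" "\<forall>x\<in>A. u \<sqsubseteq> x"
      using that by auto
    then show ?thesis
      using assms by (simp add: le_inf_iff)
  qed
  show "imp a v \<in> {v \<in> carrier L. u \<sqsubseteq> v}"
    if "a \<in> carrier L" "v \<in> {v \<in> carrier L. u \<sqsubseteq> v}" for a v
    using that assms by (simp add: le_imp_iff) (meson le_trans meet_closed meet_left)
qed auto

lemma sublocale_set_open_sublocale:
  assumes u: "u \<in> carrier L"
  shows "sublocale_set (open_sublocale u)"
  unfolding sublocale_set_def
proof (intro conjI allI impI ballI)
  show "open_sublocale u \<subseteq> carrier L" by (auto simp: open_sublocale_def)
  fix A assume A: "A \<subseteq> open_sublocale u"
  then have AL: "A \<subseteq> carrier L" by (auto simp: open_sublocale_def)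
  have "imp u (\<Sqinter>A) \<sqsubseteq> x" if "x \<in> A" for x
  proof -
    have "imp u (\<Sqinter>A) \<sqsubseteq> imp u x" "imp u x \<sqsubseteq> x" "x \<in> carrier L"
      using A AL that u by (auto simp: open_sublocale_def subset_iff intro!: imp_mono inf_lower)
    then show ?thesis by (meson imp_closed le_trans)
  qed
  then show "\<Sqinter>A \<in> open_sublocale u"
    using AL by (auto simp: open_sublocale_def le_inf_iff)
next
  fix a v assume a: "a \<in> carrier L" and v: "v \<in> open_sublocale u"
  then have vL: "v \<in> carrier L" by (simp add: open_sublocale_def)
  have "imp u (imp a v) = imp a (imp u v)"
    using a u vL by (simp add: imp_imp meet_comm)
  also have "\<dots> \<sqsubseteq> imp a v"
    using a u v by (intro imp_mono) (auto simp: open_sublocale_def)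
  finally show "imp a v \<in> open_sublocale u"
    by (simp add: open_sublocale_def)
qed

lemma nucleus_can:
  assumes "u \<in> carrier L" "x \<in> carrier L"
  shows "nucleus (can L u) x = u \<squnion> x"
proof (rule le_antisym)
  let ?S = "can L u"
  have S: "?S \<subseteq> carrier L" by (auto simp: can_def)
  show "nucleus ?S x \<sqsubseteq> u \<squnion> x"
    using assms by (subst nucleus_le_iff[OF S]) (auto simp: can_def intro: join_left join_right)
  show "u \<squnion> x \<sqsubseteq> nucleus ?S x"
    using assms nucleus_mem[OF sublocale_set_can, of u x] le_nucleus[OF S] S by (auto simp: can_def join_le_iff)
qed (use assms in \<open>auto simp: can_def\<close>)

lemma nucleus_open_sublocale:
  assumes "u \<in> carrier L" "x \<in> carrier L"
  shows "nucleus (open_sublocale u) x = imp u x"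
proof (rule le_antisym)
  have S: "open_sublocale u \<subseteq> carrier L" by (auto simp: open_sublocale_def)
  have "imp u x \<in> open_sublocale u"
    using assms le_iff_join[of u u] by (simp add: open_sublocale_def imp_imp)
  then show "nucleus (open_sublocale u) x \<sqsubseteq> imp u x"
    using assms by (subst nucleus_le_iff[OF S]) (auto simp: le_imp_iff meet_left)
  have "imp u x \<sqsubseteq> imp u (nucleus (open_sublocale u) x)"
    using assms S by (intro imp_mono) (auto simp: le_nucleus)
  moreover have "imp u (nucleus (open_sublocale u) x) \<sqsubseteq> nucleus (open_sublocale u) x"
    using nucleus_mem[OF sublocale_set_open_sublocale, of u x] assms by (simp add: open_sublocale_def)
  ultimately show "imp u x \<sqsubseteq> nucleus (open_sublocale u) x"
    using S by (meson imp_closed le_trans nucleus_closed)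
qed (use assms in \<open>auto simp: open_sublocale_def\<close>)

text \<open>
  Every sublocale is an intersection of joins of a closed and an open sublocale; in the frame of
  sublocales it is a supremum of differences of elements of the form \<open>can L v\<close>.  The index \<open>u = x\<close>
  shows that an element \<open>x\<close> of the intersection satisfies \<open>nucleus T x \<sqsubseteq> x\<close>.
\<close>

lemma sublocale_decomposition:
  assumes T: "sublocale_set T"
  shows "T = (\<Inter>u\<in>carrier L. sublocale_join (can L (nucleus T u)) (open_sublocale u)) \<inter> carrier L"
    (is "T = ?R")
proof
  note TL = sublocale_set_subset[OF T]
  have mem: "x \<in> sublocale_join (can L (nucleus T u)) (open_sublocale u)
      \<longleftrightarrow> (nucleus T u \<squnion> x) \<sqinter> imp u x \<sqsubseteq> x" if "x \<in> carrier L" "u \<in> carrier L" for x u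
    using that TL by (simp add: sublocale_join_def nucleus_can nucleus_open_sublocale)
  show "T \<subseteq> ?R"
  proof
    fix t assume t: "t \<in> T"
    then have tL: "t \<in> carrier L" using TL by blast
    have "(nucleus T u \<squnion> t) \<sqinter> imp u t \<sqsubseteq> t" if u: "u \<in> carrier L" for u
    proof -
      have "u \<sqsubseteq> imp (imp u t) t"
        using u tL imp_meet_le[of u t] by (simp add: le_imp_iff meet_comm)
      then have "nucleus T u \<sqsubseteq> imp (imp u t) t"
        using u t T TL by (simp add: nucleus_le_iff sublocale_set_imp)
      moreover have "t \<sqsubseteq> imp (imp u t) t"
        using tL by (simp add: le_imp_iff meet_left)
      ultimately show ?thesis
        using tL TL by (simp add: le_imp_iff[symmetric] join_le_iff)
    qed
    then show "t \<in> ?R"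
      using tL mem by simp
  qed
  show "?R \<subseteq> T"
  proof
    fix x assume x: "x \<in> ?R"
    then have xL: "x \<in> carrier L" by simp
    have "(nucleus T x \<squnion> x) \<sqinter> imp x x \<sqsubseteq> x"
      using x xL mem by blast
    moreover have "nucleus T x \<sqsubseteq> (nucleus T x \<squnion> x) \<sqinter> imp x x"
      using xL TL by (simp add: le_meet_iff le_imp_iff join_left meet_right)
    ultimately have "nucleus T x \<sqsubseteq> x"
      using xL TL by (meson imp_closed join_closed le_trans meet_closed nucleus_closed)
    then show "x \<in> T"
      using sublocale_set_memI[OF T xL] by simp
  qed
qed

lemma carrier_Sl_frame: "carrier (Sl_frame L) = {S. sublocale_set S}"
  by (simp add: Sl_frame_def set_order_def is_sublocale_iff)

lemma le_Sl_frame: "S \<sqsubseteq>\<^bsub>Sl_frame L\<^esub> T \<longleftrightarrow> T \<subseteq> S"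
  by (simp add: Sl_frame_def set_order_def)

lemma partial_order_Sl_frame: "partial_order (Sl_frame L)"
  by unfold_locales (auto simp: Sl_frame_def set_order_def)

lemma
  shows frame_Sl_frame: "frame (Sl_frame L)"
    and sup_Sl_frame: "\<S> \<subseteq> carrier (Sl_frame L) \<Longrightarrow> \<Squnion>\<^bsub>Sl_frame L\<^esub>\<S> = \<Inter>\<S> \<inter> carrier L"
    and meet_Sl_frame: "\<lbrakk>sublocale_set S; sublocale_set T\<rbrakk> \<Longrightarrow> S \<sqinter>\<^bsub>Sl_frame L\<^esub> T = sublocale_join S T"
proof -
  let ?C = "carrier (Sl_frame L)" and ?s = "\<lambda>\<S>. \<Inter>\<S> \<inter> carrier L"
  have 1: "?s \<S> \<in> ?C" if "\<S> \<subseteq> ?C" for \<S>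
    using that sublocale_set_Inter[of \<S>] by (auto simp: carrier_Sl_frame)
  have 2: "S \<sqsubseteq>\<^bsub>Sl_frame L\<^esub> ?s \<S>" if "\<S> \<subseteq> ?C" "S \<in> \<S>" for S \<S>
    using that by (auto simp: le_Sl_frame)
  have 3: "?s \<S> \<sqsubseteq>\<^bsub>Sl_frame L\<^esub> T"
    if "\<S> \<subseteq> ?C" "T \<in> ?C" "\<And>S. S \<in> \<S> \<Longrightarrow> S \<sqsubseteq>\<^bsub>Sl_frame L\<^esub> T" for T \<S>
    using that sublocale_set_subset[of T] unfolding carrier_Sl_frame le_Sl_frame by blast
  have 4: "sublocale_join S T \<in> ?C" if "S \<in> ?C" "T \<in> ?C" for S T
    using that by (simp add: carrier_Sl_frame sublocale_set_join)
  have 5: "sublocale_join S T \<sqsubseteq>\<^bsub>Sl_frame L\<^esub> S" "sublocale_join S T \<sqsubseteq>\<^bsub>Sl_frame L\<^esub> T"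
    if "S \<in> ?C" "T \<in> ?C" for S T
    using that by (simp_all add: carrier_Sl_frame le_Sl_frame sublocale_join_upper)
  have 6: "R \<sqsubseteq>\<^bsub>Sl_frame L\<^esub> sublocale_join S T"
    if "S \<in> ?C" "T \<in> ?C" "R \<in> ?C" "R \<sqsubseteq>\<^bsub>Sl_frame L\<^esub> S" "R \<sqsubseteq>\<^bsub>Sl_frame L\<^esub> T" for R S T
    using that by (simp add: carrier_Sl_frame le_Sl_frame sublocale_join_least)
  have 7: "sublocale_join S (?s \<T>) \<sqsubseteq>\<^bsub>Sl_frame L\<^esub> ?s (sublocale_join S ` \<T>)"
    if "S \<in> ?C" "\<T> \<subseteq> ?C" for S \<T>
    unfolding le_Sl_frame using that
    by (intro sublocale_join_Inter) (auto simp: carrier_Sl_frame)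
  note * = frame_explicit[where m = sublocale_join and s = ?s, OF partial_order_Sl_frame 1 2 3 4 5 6 7]
  show "frame (Sl_frame L)"
    by (rule *(1))
  show "\<S> \<subseteq> ?C \<Longrightarrow> \<Squnion>\<^bsub>Sl_frame L\<^esub>\<S> = ?s \<S>"
    by (rule *(2))
  show "\<lbrakk>sublocale_set S; sublocale_set T\<rbrakk> \<Longrightarrow> S \<sqinter>\<^bsub>Sl_frame L\<^esub> T = sublocale_join S T"
    by (rule *(3)) (simp_all add: carrier_Sl_frame)
qed

end

section \<open>Lifts to the frame of sublocales\<close>

context frame
begin

definition complements :: "'a \<Rightarrow> 'a \<Rightarrow> bool" where
  "complements a b \<longleftrightarrow> a \<in> carrier L \<and> b \<in> carrier L \<and> a \<sqinter> b = \<bottom> \<and> a \<squnion> b = \<top>"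

text \<open>
  A complemented element can be moved across an inequality; the calculus of set differences.
\<close>

lemma meet_complement_le_iff:
  assumes "complements a b" "x \<in> carrier L" "m \<in> carrier L"
  shows "x \<sqinter> b \<sqsubseteq> m \<longleftrightarrow> x \<sqsubseteq> m \<squnion> a"
proof -
  have ab: "a \<in> carrier L" "b \<in> carrier L" "a \<sqinter> b = \<bottom>" "a \<squnion> b = \<top>"
    using assms(1) by (auto simp: complements_def)
  show ?thesis
  proof
    assume le: "x \<sqinter> b \<sqsubseteq> m"
    have "x = x \<sqinter> (a \<squnion> b)"
      using assms ab le_iff_join[of x \<top>] by simp
    also have "\<dots> = (x \<sqinter> a) \<squnion> (x \<sqinter> b)"
      using assms ab(1,2) by (rule_tac meet_join_distrib)
    also have "\<dots> \<sqsubseteq> a \<squnion> m"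
      using assms ab le by (simp add: join_le_iff le_trans[OF meet_right join_left] le_trans[OF le join_right])
    finally show "x \<sqsubseteq> m \<squnion> a"
      by (simp add: join_comm)
  next
    assume le: "x \<sqsubseteq> m \<squnion> a"
    have "x \<sqinter> b \<sqsubseteq> (m \<squnion> a) \<sqinter> b"
      using assms ab le by (intro meet_mono) auto
    also have "\<dots> = (m \<sqinter> b) \<squnion> (a \<sqinter> b)"
      using assms ab meet_join_distrib[of b m a] by (simp add: meet_comm[of L _ b])
    also have "\<dots> \<sqsubseteq> m"
      using assms ab by (simp add: join_le_iff meet_left)
    finally show "x \<sqinter> b \<sqsubseteq> m"
      using assms ab by simp
  qed
qed

lemma complements_join:
  assumes "complements a a'" "complements b b'"
  shows "complements (a \<squnion> b) (a' \<sqinter> b')"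
proof -
  have ab: "a \<in> carrier L" "a' \<in> carrier L" "b \<in> carrier L" "b' \<in> carrier L"
    using assms by (auto simp: complements_def)
  have *: "(a' \<sqinter> b') \<sqsubseteq> m \<longleftrightarrow> \<top> \<sqsubseteq> m \<squnion> (a \<squnion> b)" if "m \<in> carrier L" for m
  proof -
    have t: "\<top> \<sqinter> a' = a'"
      using ab le_iff_join[of a' "\<top>"] by (simp add: meet_comm)
    have "(a' \<sqinter> b') \<sqsubseteq> m \<longleftrightarrow> \<top> \<sqinter> a' \<sqsubseteq> m \<squnion> b"
      using ab that by (simp add: meet_complement_le_iff[OF assms(2)] t)
    also have "\<dots> \<longleftrightarrow> \<top> \<sqsubseteq> (m \<squnion> b) \<squnion> a"
      using ab that by (simp add: meet_complement_le_iff[OF assms(1)])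
    finally show ?thesis
      using ab that by (simp add: join_assoc join_comm[of L a b])
  qed
  have "(a \<squnion> b) \<squnion> (a' \<sqinter> b') = \<top>"
    using *[of "a' \<sqinter> b'"] ab by (intro le_antisym) (auto simp: join_comm)
  moreover have "(a \<squnion> b) \<sqinter> (a' \<sqinter> b') = \<bottom>"
  proof (rule le_antisym)
    have "(a \<squnion> b) \<sqinter> a' \<sqsubseteq> b"
      using ab by (simp add: meet_complement_le_iff[OF assms(1)] join_comm[of L b a])
    then have "((a \<squnion> b) \<sqinter> a') \<sqinter> b' \<sqsubseteq> \<bottom>"
      using ab by (subst meet_complement_le_iff[OF assms(2)])
        (auto intro: le_trans[OF _ join_right])
    then show "(a \<squnion> b) \<sqinter> (a' \<sqinter> b') \<sqsubseteq> \<bottom>"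
      using ab by (simp add: meet_assoc)
  qed (use ab in auto)
  ultimately show ?thesis
    using ab by (simp add: complements_def)
qed

lemma complement_unique:
  assumes "complements a b" "complements a b'"
  shows "b = b'"
proof -
  have le: "b \<sqsubseteq> b'" if "complements a b" "complements a b'" for b b'
  proof -
    have c: "a \<in> carrier L" "b \<in> carrier L" "b' \<in> carrier L" "b' \<squnion> a = \<top>"
      using that by (auto simp: complements_def join_comm)
    then have "\<top> \<sqinter> b \<sqsubseteq> b'"
      using meet_complement_le_iff[OF that(1), of \<top> b'] by simp
    moreover have "\<top> \<sqinter> b = b"
      using c le_iff_join[of b \<top>] by (simp add: meet_comm)
    ultimately show ?thesis by simp
  qed
  show ?thesis
    using assms le[of b b'] le[of b' b] by (intro le_antisym) (auto simp: complements_def)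
qed

end

lemma (in complete_lattice) sup_empty_eq_bottom: "\<Squnion>{} = \<bottom>"
  using weak_sup_empty unfolding eq_is_equal .

lemma frame_hom_mono:
  assumes f: "frame_hom L M f" and "u \<in> carrier L" "v \<in> carrier L" "u \<sqsubseteq>\<^bsub>L\<^esub> v"
  shows "f u \<sqsubseteq>\<^bsub>M\<^esub> f v"
proof -
  interpret L: frame L using f by (simp add: frame_hom_def)
  interpret M: frame M using f by (simp add: frame_hom_def)
  have "u = u \<sqinter>\<^bsub>L\<^esub> v"
    using assms by (simp add: L.le_iff_join[symmetric])
  then have "f u = f u \<sqinter>\<^bsub>M\<^esub> f v"
    using assms by (metis frame_hom_def)
  moreover have "f u \<in> carrier M" "f v \<in> carrier M"
    using assms by (auto simp: frame_hom_def)
  ultimately show ?thesis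
    by (simp add: M.le_iff_join)
qed

lemma frame_hom_complements:
  assumes f: "frame_hom L M f" and ab: "frame.complements L a b"
  shows "frame.complements M (f a) (f b)"
proof -
  interpret L: frame L using f by (simp add: frame_hom_def)
  interpret M: frame M using f by (simp add: frame_hom_def)
  have ab: "a \<in> carrier L" "b \<in> carrier L" "a \<sqinter>\<^bsub>L\<^esub> b = \<bottom>\<^bsub>L\<^esub>" "a \<squnion>\<^bsub>L\<^esub> b = \<top>\<^bsub>L\<^esub>"
    using ab by (auto simp: L.complements_def)
  have bot: "f \<bottom>\<^bsub>L\<^esub> = \<bottom>\<^bsub>M\<^esub>"
    using f unfolding frame_hom_def
    by (metis L.sup_empty_eq_bottom M.sup_empty_eq_bottom empty_subsetI image_empty)
  have "f a \<sqinter>\<^bsub>M\<^esub> f b = f (a \<sqinter>\<^bsub>L\<^esub> b)"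
    using f ab(1,2) by (simp add: frame_hom_def)
  moreover have "f a \<squnion>\<^bsub>M\<^esub> f b = f (a \<squnion>\<^bsub>L\<^esub> b)"
    using f ab(1,2) by (simp add: frame_hom_def join_def)
  moreover have "f a \<in> carrier M" "f b \<in> carrier M" "f \<top>\<^bsub>L\<^esub> = \<top>\<^bsub>M\<^esub>"
    using f ab(1,2) by (auto simp: frame_hom_def)
  ultimately show ?thesis
    by (simp add: M.complements_def ab bot)
qed

context ambient_frame
begin

sublocale Sl: frame "Sl_frame L"
  by (rule frame_Sl_frame)

lemma top_Sl_frame: "\<top>\<^bsub>Sl_frame L\<^esub> = {\<top>}"
proof (rule Sl.top_equality)
  have top: "\<Sqinter>A = \<top>" if "A \<subseteq> {\<top>}" for A
  proof -
    have "A \<subseteq> carrier L" "\<forall>x\<in>A. \<top> \<sqsubseteq> x"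
      using that by auto
    then show ?thesis
      by (intro le_antisym) (simp_all add: le_inf_iff)
  qed
  have "imp a \<top> = \<top>" if "a \<in> carrier L" for a
    using that by (intro le_antisym) (auto simp: le_imp_iff)
  then show "{\<top>} \<in> carrier (Sl_frame L)"
    using top by (simp add: carrier_Sl_frame sublocale_set_def)
  show "S \<sqsubseteq>\<^bsub>Sl_frame L\<^esub> {\<top>}" if "S \<in> carrier (Sl_frame L)" for S
    using that top[of "{}"] sublocale_set_inf[of S "{}"] by (simp add: carrier_Sl_frame le_Sl_frame)
qed

lemma bottom_Sl_frame: "\<bottom>\<^bsub>Sl_frame L\<^esub> = carrier L"
  by (rule Sl.bottom_equality)
    (auto simp: carrier_Sl_frame le_Sl_frame sublocale_set_carrier dest: sublocale_set_subset)

lemma complements_can_open_sublocale: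
  assumes u: "u \<in> carrier L"
  shows "Sl.complements (can L u) (open_sublocale u)"
proof -
  have can: "sublocale_set (can L u)" and open_sublocale: "sublocale_set (open_sublocale u)"
    using u by (simp_all add: sublocale_set_can sublocale_set_open_sublocale)
  have "can L u \<sqinter>\<^bsub>Sl_frame L\<^esub> open_sublocale u = carrier L"
  proof -
    have "(u \<squnion> x) \<sqinter> imp u x \<sqsubseteq> x" if x: "x \<in> carrier L" for x
    proof -
      have "imp u x \<sqinter> (u \<squnion> x) = (imp u x \<sqinter> u) \<squnion> (imp u x \<sqinter> x)"
        using u x by (simp add: meet_join_distrib)
      also have "\<dots> \<sqsubseteq> x"
        using u x by (simp add: join_le_iff imp_meet_le meet_right)
      finally show ?thesis
        by (simp add: meet_comm)
    qed
    then show ?thesis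
      using u can open_sublocale
      by (auto simp: meet_Sl_frame sublocale_join_def nucleus_open_sublocale nucleus_can)
  qed
  moreover have "can L u \<squnion>\<^bsub>Sl_frame L\<^esub> open_sublocale u = {\<top>}"
  proof -
    have "v = \<top>" if v: "v \<in> carrier L" "u \<sqsubseteq> v" "imp u v \<sqsubseteq> v" for v
    proof (rule le_antisym)
      have "\<top> \<sqsubseteq> imp u v"
        using u v le_trans[OF meet_right v(2), of \<top>] by (simp add: le_imp_iff)
      from le_trans[OF this v(3)] show "\<top> \<sqsubseteq> v"
        using v by simp
    qed (use v in auto)
    moreover have "\<top> \<in> can L u" "\<top> \<in> open_sublocale u"
      using u by (auto simp: can_def open_sublocale_def)
    ultimately have "can L u \<inter> open_sublocale u \<inter> carrier L = {\<top>}"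
      unfolding can_def open_sublocale_def by blast
    then show ?thesis
      unfolding join_def using can open_sublocale by (subst sup_Sl_frame) (auto simp: carrier_Sl_frame)
  qed
  ultimately show ?thesis
    using can open_sublocale by (simp add: Sl.complements_def carrier_Sl_frame top_Sl_frame bottom_Sl_frame)
qed

end

text \<open>
  Frame homomorphisms \<open>f\<close> from \<open>L\<close> to \<open>M\<close> along which lifts to the frame of sublocales exist: each value
  of \<open>f\<close> has a complement in \<open>M\<close>, with \<open>c\<close> choosing it.  Every \<open>f\<close> into a Boolean frame is of this kind.
\<close>

locale complemented_frame_hom = L: ambient_frame L + M: ambient_frame M
  for L :: "'a gorder" and M :: "'b gorder" +
  fixes f :: "'a \<Rightarrow> 'b" and c :: "'a \<Rightarrow> 'b"
  assumes hom: "frame_hom L M f"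
    and compl: "u \<in> carrier L \<Longrightarrow> M.complements (f u) (c u)"
begin

lemma f_closed [simp]: "u \<in> carrier L \<Longrightarrow> f u \<in> carrier M"
  using hom by (auto simp: frame_hom_def)

lemma c_closed [simp]: "u \<in> carrier L \<Longrightarrow> c u \<in> carrier M"
  using compl by (auto simp: M.complements_def)

lemma f_sup: "A \<subseteq> carrier L \<Longrightarrow> f (\<Squnion>\<^bsub>L\<^esub>A) = \<Squnion>\<^bsub>M\<^esub>(f ` A)"
  using hom by (simp add: frame_hom_def)

lemma f_join: "\<lbrakk>u \<in> carrier L; v \<in> carrier L\<rbrakk> \<Longrightarrow> f (u \<squnion>\<^bsub>L\<^esub> v) = f u \<squnion>\<^bsub>M\<^esub> f v"
  using f_sup[of "{u, v}"] by (simp add: join_def)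

lemma f_meet: "\<lbrakk>u \<in> carrier L; v \<in> carrier L\<rbrakk> \<Longrightarrow> f (u \<sqinter>\<^bsub>L\<^esub> v) = f u \<sqinter>\<^bsub>M\<^esub> f v"
  using hom by (simp add: frame_hom_def)

lemma f_mono: "\<lbrakk>u \<in> carrier L; v \<in> carrier L; u \<sqsubseteq>\<^bsub>L\<^esub> v\<rbrakk> \<Longrightarrow> f u \<sqsubseteq>\<^bsub>M\<^esub> f v"
  by (rule frame_hom_mono[OF hom])

text \<open>
  The value forced on a lift by \<open>sublocale_decomposition\<close>.
\<close>

definition explicit_lift :: "'a set \<Rightarrow> 'b" where
  "explicit_lift T = \<Squnion>\<^bsub>M\<^esub>((\<lambda>u. f (L.nucleus T u) \<sqinter>\<^bsub>M\<^esub> c u) ` carrier L)"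

context
  fixes T assumes T: "L.sublocale_set T"
begin

lemma explicit_lift_subset:
  "(\<lambda>u. f (L.nucleus T u) \<sqinter>\<^bsub>M\<^esub> c u) ` carrier L \<subseteq> carrier M"
  using L.sublocale_set_subset[OF T] by auto

lemma explicit_lift_closed [simp]: "explicit_lift T \<in> carrier M"
  unfolding explicit_lift_def by (rule M.sup_closed) (rule explicit_lift_subset)

lemma explicit_lift_upper:
  "u \<in> carrier L \<Longrightarrow> f (L.nucleus T u) \<sqinter>\<^bsub>M\<^esub> c u \<sqsubseteq>\<^bsub>M\<^esub> explicit_lift T"
  unfolding explicit_lift_def by (rule M.sup_upper) (use explicit_lift_subset in auto)

lemma explicit_lift_le_iff:
  assumes "m \<in> carrier M"
  shows "explicit_lift T \<sqsubseteq>\<^bsub>M\<^esub> m \<longleftrightarrow> (\<forall>u\<in>carrier L. f (L.nucleus T u) \<sqsubseteq>\<^bsub>M\<^esub> m \<squnion>\<^bsub>M\<^esub> f u)"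
proof -
  have "f (L.nucleus T u) \<sqinter>\<^bsub>M\<^esub> c u \<sqsubseteq>\<^bsub>M\<^esub> m \<longleftrightarrow> f (L.nucleus T u) \<sqsubseteq>\<^bsub>M\<^esub> m \<squnion>\<^bsub>M\<^esub> f u"
    if "u \<in> carrier L" for u
    using that assms L.sublocale_set_subset[OF T]
    by (intro M.meet_complement_le_iff compl) auto
  then show ?thesis
    using assms unfolding explicit_lift_def by (simp add: M.sup_le_iff explicit_lift_subset)
qed

end

lemma explicit_lift_antimono:
  assumes "L.sublocale_set S" "L.sublocale_set T" "S \<subseteq> T"
  shows "explicit_lift T \<sqsubseteq>\<^bsub>M\<^esub> explicit_lift S"
proof -
  have "f (L.nucleus T u) \<sqsubseteq>\<^bsub>M\<^esub> explicit_lift S \<squnion>\<^bsub>M\<^esub> f u" if u: "u \<in> carrier L" for u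
  proof -
    note SL = L.sublocale_set_subset[OF assms(1)] and TL = L.sublocale_set_subset[OF assms(2)]
    have "L.nucleus T u \<sqsubseteq>\<^bsub>L\<^esub> L.nucleus S u"
      using u SL TL assms(3) L.nucleus_mem[OF assms(1), of u] L.le_nucleus[OF SL u]
      by (subst L.nucleus_le_iff) auto
    then have "f (L.nucleus T u) \<sqsubseteq>\<^bsub>M\<^esub> f (L.nucleus S u)"
      using u SL TL by (intro f_mono) auto
    moreover have "f (L.nucleus S u) \<sqsubseteq>\<^bsub>M\<^esub> explicit_lift S \<squnion>\<^bsub>M\<^esub> f u"
      using explicit_lift_le_iff[OF assms(1), of "explicit_lift S"] assms(1) u by simp
    ultimately show ?thesis
      using u SL TL assms(1) M.le_trans by simp
  qed
  then show ?thesis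
    using assms by (simp add: explicit_lift_le_iff)
qed

text \<open>
  Fix an upper bound \<open>m\<close> of the lifted members of \<open>\<T>\<close> and an element \<open>u\<close>, and let \<open>W\<close> be the largest
  element with \<open>f W \<sqsubseteq> m \<squnion> f u\<close>.  The bound for \<open>T\<close> at the index \<open>W\<close> says that \<open>nucleus T W\<close> satisfies the
  same inequality, so \<open>W\<close> belongs to every \<open>T \<in> \<T>\<close>.  Being above \<open>u\<close>, it bounds the nucleus of the
  intersection at \<open>u\<close>.
\<close>

lemma explicit_lift_Inter:
  assumes \<T>: "\<And>T. T \<in> \<T> \<Longrightarrow> L.sublocale_set T"
  shows "explicit_lift (\<Inter>\<T> \<inter> carrier L) = \<Squnion>\<^bsub>M\<^esub>(explicit_lift ` \<T>)"
proof (rule M.le_antisym)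
  let ?I = "\<Inter>\<T> \<inter> carrier L" and ?m = "\<Squnion>\<^bsub>M\<^esub>(explicit_lift ` \<T>)"
  have I: "L.sublocale_set ?I"
    using \<T> by (rule L.sublocale_set_Inter)
  note IL = L.sublocale_set_subset[OF I]
  have sub: "explicit_lift ` \<T> \<subseteq> carrier M"
    using \<T> by auto
  then have m: "?m \<in> carrier M" by simp
  show "explicit_lift ?I \<in> carrier M" "?m \<in> carrier M"
    using I m by simp_all
  show "?m \<sqsubseteq>\<^bsub>M\<^esub> explicit_lift ?I"
    using sub I \<T> by (auto simp: M.sup_le_iff intro!: explicit_lift_antimono)
  have "f (L.nucleus ?I u) \<sqsubseteq>\<^bsub>M\<^esub> ?m \<squnion>\<^bsub>M\<^esub> f u" if u: "u \<in> carrier L" for u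
  proof -
    let ?n = "?m \<squnion>\<^bsub>M\<^esub> f u"
    let ?A = "{w \<in> carrier L. f w \<sqsubseteq>\<^bsub>M\<^esub> ?n}"
    let ?W = "\<Squnion>\<^bsub>L\<^esub>?A"
    have A: "?A \<subseteq> carrier L" by blast
    have n: "?n \<in> carrier M" using u m by simp
    have W: "?W \<in> carrier L" using A by (rule L.sup_closed)
    have fW: "f ?W \<sqsubseteq>\<^bsub>M\<^esub> ?n"
      using n by (simp add: f_sup[OF A] M.sup_le_iff image_subset_iff)
    have "?W \<in> T" if T: "T \<in> \<T>" for T
    proof (rule L.sublocale_set_memI[OF \<T>[OF T] W], rule L.sup_upper[OF A])
      note TL = L.sublocale_set_subset[OF \<T>[OF T]]
      have "explicit_lift T \<sqsubseteq>\<^bsub>M\<^esub> ?m"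
        using sub T by (intro M.sup_upper) auto
      then have "f (L.nucleus T ?W) \<sqsubseteq>\<^bsub>M\<^esub> ?m \<squnion>\<^bsub>M\<^esub> f ?W"
        using W m by (simp add: explicit_lift_le_iff \<T>[OF T])
      moreover have "?m \<squnion>\<^bsub>M\<^esub> f ?W \<sqsubseteq>\<^bsub>M\<^esub> ?n"
        using W u m n fW by (simp add: M.join_le_iff[OF _ _ n] M.join_left)
      ultimately show "L.nucleus T ?W \<in> ?A"
        using TL W m n M.le_trans[of "f (L.nucleus T ?W)" "?m \<squnion>\<^bsub>M\<^esub> f ?W" ?n] by simp
    qed
    then have "?W \<in> ?I"
      using W by simp
    moreover have "u \<sqsubseteq>\<^bsub>L\<^esub> ?W"
      using u m by (intro L.sup_upper[OF A]) (simp add: M.join_right)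
    ultimately have "L.nucleus ?I u \<sqsubseteq>\<^bsub>L\<^esub> ?W"
      by (subst L.nucleus_le_iff[OF IL u])
    then have "f (L.nucleus ?I u) \<sqsubseteq>\<^bsub>M\<^esub> f ?W"
      using W IL by (intro f_mono) auto
    then show ?thesis
      using fW W IL n M.le_trans[of "f (L.nucleus ?I u)" "f ?W" ?n] by simp
  qed
  then show "explicit_lift ?I \<sqsubseteq>\<^bsub>M\<^esub> ?m"
    using m by (simp add: explicit_lift_le_iff I)
qed

text \<open>
  The term of \<open>explicit_lift S\<close> at \<open>u\<close> and that of \<open>explicit_lift T\<close> at \<open>v\<close> meet below the term of the
  join at \<open>u \<squnion> v\<close>, because \<open>nucleus S u \<sqinter> nucleus T v\<close> is below the nucleus of the join there.
  Distributing meets over the suprema gives the nontrivial inequality.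
\<close>

lemma explicit_lift_join:
  assumes S: "L.sublocale_set S" and T: "L.sublocale_set T"
  shows "explicit_lift (L.sublocale_join S T) = explicit_lift S \<sqinter>\<^bsub>M\<^esub> explicit_lift T"
proof (rule M.le_antisym)
  let ?J = "L.sublocale_join S T"
  note SL = L.sublocale_set_subset[OF S] and TL = L.sublocale_set_subset[OF T]
  have J: "L.sublocale_set ?J" using S T by (rule L.sublocale_set_join)
  note JL = L.sublocale_set_subset[OF J]
  show "explicit_lift ?J \<sqsubseteq>\<^bsub>M\<^esub> explicit_lift S \<sqinter>\<^bsub>M\<^esub> explicit_lift T"
    using S T J by (simp add: M.le_meet_iff explicit_lift_antimono L.sublocale_join_upper)
  let ?s = "\<lambda>u. f (L.nucleus S u) \<sqinter>\<^bsub>M\<^esub> c u" and ?t = "\<lambda>u. f (L.nucleus T u) \<sqinter>\<^bsub>M\<^esub> c u"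
  have st: "?s u \<sqinter>\<^bsub>M\<^esub> ?t v \<sqsubseteq>\<^bsub>M\<^esub> explicit_lift ?J" if u: "u \<in> carrier L" and v: "v \<in> carrier L" for u v
  proof -
    let ?w = "u \<squnion>\<^bsub>L\<^esub> v"
    have w: "?w \<in> carrier L" using u v by simp
    have cw: "c ?w = c u \<sqinter>\<^bsub>M\<^esub> c v"
      using compl[OF w] M.complements_join[OF compl[OF u] compl[OF v]] u v
      by (auto simp: f_join intro: M.complement_unique)
    have le: "L.nucleus S u \<sqinter>\<^bsub>L\<^esub> L.nucleus T v \<sqsubseteq>\<^bsub>L\<^esub> L.nucleus ?J ?w"
    proof -
      have x: "L.nucleus ?J ?w \<in> ?J" using J by (rule L.nucleus_mem)
      then have "L.nucleus S (L.nucleus ?J ?w) \<sqinter>\<^bsub>L\<^esub> L.nucleus T (L.nucleus ?J ?w) \<sqsubseteq>\<^bsub>L\<^esub> L.nucleus ?J ?w"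
        by (simp add: L.sublocale_join_def)
      moreover have wx: "?w \<sqsubseteq>\<^bsub>L\<^esub> L.nucleus ?J ?w"
        using JL w by (rule L.le_nucleus)
      then have "u \<sqsubseteq>\<^bsub>L\<^esub> L.nucleus ?J ?w" "v \<sqsubseteq>\<^bsub>L\<^esub> L.nucleus ?J ?w"
        using u v JL by (simp_all add: L.join_le_iff)
      then have "L.nucleus S u \<sqinter>\<^bsub>L\<^esub> L.nucleus T v
          \<sqsubseteq>\<^bsub>L\<^esub> L.nucleus S (L.nucleus ?J ?w) \<sqinter>\<^bsub>L\<^esub> L.nucleus T (L.nucleus ?J ?w)"
        using u v S T SL TL JL by (intro L.meet_mono L.nucleus_mono) auto
      ultimately show ?thesis
        using SL TL JL
          L.le_trans[of "L.nucleus S u \<sqinter>\<^bsub>L\<^esub> L.nucleus T v"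
            "L.nucleus S (L.nucleus ?J ?w) \<sqinter>\<^bsub>L\<^esub> L.nucleus T (L.nucleus ?J ?w)"] by simp
    qed
    have "?s u \<sqinter>\<^bsub>M\<^esub> ?t v \<sqsubseteq>\<^bsub>M\<^esub> f (L.nucleus ?J ?w) \<sqinter>\<^bsub>M\<^esub> c ?w"
    proof -
      have "f (L.nucleus S u) \<sqinter>\<^bsub>M\<^esub> f (L.nucleus T v) \<sqsubseteq>\<^bsub>M\<^esub> f (L.nucleus ?J ?w)"
        using f_mono[OF _ _ le] SL TL JL by (simp add: f_meet)
      then have "(f (L.nucleus S u) \<sqinter>\<^bsub>M\<^esub> f (L.nucleus T v)) \<sqinter>\<^bsub>M\<^esub> (c u \<sqinter>\<^bsub>M\<^esub> c v)
          \<sqsubseteq>\<^bsub>M\<^esub> f (L.nucleus ?J ?w) \<sqinter>\<^bsub>M\<^esub> (c u \<sqinter>\<^bsub>M\<^esub> c v)"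
        using u v SL TL JL by (intro M.meet_mono) auto
      moreover have "(f (L.nucleus S u) \<sqinter>\<^bsub>M\<^esub> f (L.nucleus T v)) \<sqinter>\<^bsub>M\<^esub> (c u \<sqinter>\<^bsub>M\<^esub> c v)
          = ?s u \<sqinter>\<^bsub>M\<^esub> ?t v"
        using u v SL TL M.meet_assoc meet_comm[of M "c u" "f (L.nucleus T v) \<sqinter>\<^bsub>M\<^esub> c v"]
          meet_comm[of M "c v" "c u"] by (simp add: M.meet_assoc)
      ultimately show ?thesis
        by (simp add: cw)
    qed
    then show ?thesis
      using explicit_lift_upper[OF J w] u v w SL TL JL J
        M.le_trans[of "?s u \<sqinter>\<^bsub>M\<^esub> ?t v" "f (L.nucleus ?J ?w) \<sqinter>\<^bsub>M\<^esub> c ?w"] by simp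
  qed
  have "explicit_lift S \<sqinter>\<^bsub>M\<^esub> ?t v \<sqsubseteq>\<^bsub>M\<^esub> explicit_lift ?J" if v: "v \<in> carrier L" for v
  proof -
    have tv: "?t v \<in> carrier M" using v TL by simp
    have "?t v \<sqinter>\<^bsub>M\<^esub> explicit_lift S = \<Squnion>\<^bsub>M\<^esub>((\<lambda>x. ?t v \<sqinter>\<^bsub>M\<^esub> x) ` (?s ` carrier L))"
      unfolding explicit_lift_def by (rule M.meet_Sup_distrib[OF tv]) (rule explicit_lift_subset[OF S])
    also have "\<dots> \<sqsubseteq>\<^bsub>M\<^esub> explicit_lift ?J"
      using st v tv SL J by (subst M.sup_le_iff) (auto simp: meet_comm[of M "?t v"])
    finally show ?thesis by (simp add: meet_comm)
  qed note sv = this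
  have "explicit_lift S \<sqinter>\<^bsub>M\<^esub> explicit_lift T
      = \<Squnion>\<^bsub>M\<^esub>((\<lambda>x. explicit_lift S \<sqinter>\<^bsub>M\<^esub> x) ` (?t ` carrier L))"
    unfolding explicit_lift_def[of T]
    by (rule M.meet_Sup_distrib) (use S in \<open>auto intro!: explicit_lift_subset[OF T]\<close>)
  also have "\<dots> \<sqsubseteq>\<^bsub>M\<^esub> explicit_lift ?J"
    using sv S TL J by (subst M.sup_le_iff) auto
  finally show "explicit_lift S \<sqinter>\<^bsub>M\<^esub> explicit_lift T \<sqsubseteq>\<^bsub>M\<^esub> explicit_lift ?J" .
qed (use S T L.sublocale_set_join[OF S T] in auto)

lemma explicit_lift_can:
  assumes u: "u \<in> carrier L"
  shows "explicit_lift (can L u) = f u"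
proof (rule M.le_antisym)
  have can: "L.sublocale_set (can L u)" using u by (rule L.sublocale_set_can)
  have nuc: "L.nucleus (can L u) v = u \<squnion>\<^bsub>L\<^esub> v" if "v \<in> carrier L" for v
    using u that by (rule L.nucleus_can)
  show "explicit_lift (can L u) \<sqsubseteq>\<^bsub>M\<^esub> f u"
    using u by (simp add: explicit_lift_le_iff[OF can] nuc f_join)
  \<comment> \<open>The supremum is attained at the index \<open>\<bottom>\<close>, where nothing is subtracted.\<close>
  have b: "\<bottom>\<^bsub>L\<^esub> \<in> carrier L" by simp
  have fb: "f \<bottom>\<^bsub>L\<^esub> = \<bottom>\<^bsub>M\<^esub>"
    using f_sup[of "{}"] by (simp add: L.sup_empty_eq_bottom M.sup_empty_eq_bottom)
  have "f u \<sqsubseteq>\<^bsub>M\<^esub> f (u \<squnion>\<^bsub>L\<^esub> \<bottom>\<^bsub>L\<^esub>)"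
    using u by (intro f_mono) (auto intro: L.join_left)
  moreover have "f (u \<squnion>\<^bsub>L\<^esub> \<bottom>\<^bsub>L\<^esub>) \<sqsubseteq>\<^bsub>M\<^esub> explicit_lift (can L u) \<squnion>\<^bsub>M\<^esub> f \<bottom>\<^bsub>L\<^esub>"
    using explicit_lift_le_iff[OF can, of "explicit_lift (can L u)"] can b
    by (simp flip: nuc[OF b])
  moreover have "explicit_lift (can L u) \<squnion>\<^bsub>M\<^esub> f \<bottom>\<^bsub>L\<^esub> \<sqsubseteq>\<^bsub>M\<^esub> explicit_lift (can L u)"
    using can by (simp add: fb M.join_le_iff)
  ultimately show "f u \<sqsubseteq>\<^bsub>M\<^esub> explicit_lift (can L u)"
    using u can fb by (meson M.bottom_closed M.join_closed M.le_trans L.bottom_closed L.join_closed f_closed explicit_lift_closed)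
qed (use u L.sublocale_set_can in auto)

lemma frame_hom_explicit_lift: "frame_hom (Sl_frame L) M explicit_lift"
proof -
  have top: "L.sublocale_set {\<top>\<^bsub>L\<^esub>}"
    using L.Sl.top_closed by (simp add: L.top_Sl_frame L.carrier_Sl_frame)
  have "can L \<top>\<^bsub>L\<^esub> = {\<top>\<^bsub>L\<^esub>}"
    by (auto simp: can_def intro: L.le_antisym)
  then have "explicit_lift {\<top>\<^bsub>L\<^esub>} = \<top>\<^bsub>M\<^esub>"
    using explicit_lift_can[of "\<top>\<^bsub>L\<^esub>"] hom by (simp add: frame_hom_def)
  then show ?thesis
    unfolding frame_hom_def
    by (auto simp: L.frame_Sl_frame M.frame_axioms L.carrier_Sl_frame L.sup_Sl_frame L.meet_Sl_frame
        explicit_lift_join L.top_Sl_frame subset_iff intro!: explicit_lift_Inter)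
qed

text \<open>
  A lift sends \<open>can L u\<close> to \<open>f u\<close>, hence the complement \<open>open_sublocale u\<close> to \<open>c u\<close>, and the
  decomposition of \<open>T\<close> determines the rest.
\<close>

lemma frame_hom_Sl_frame_unique:
  assumes g: "frame_hom (Sl_frame L) M g" and gf: "\<And>u. u \<in> carrier L \<Longrightarrow> g (can L u) = f u"
    and T: "L.sublocale_set T"
  shows "g T = explicit_lift T"
proof -
  note TL = L.sublocale_set_subset[OF T]
  have g_open: "g (L.open_sublocale u) = c u" if u: "u \<in> carrier L" for u
    using frame_hom_complements[OF g L.complements_can_open_sublocale[OF u]] compl[OF u] gf[OF u]
    by (auto intro: M.complement_unique)
  let ?\<S> = "(\<lambda>u. L.sublocale_join (can L (L.nucleus T u)) (L.open_sublocale u)) ` carrier L"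
  have sub: "?\<S> \<subseteq> carrier (Sl_frame L)"
    using TL by (auto simp: L.carrier_Sl_frame intro!: L.sublocale_set_join L.sublocale_set_can L.sublocale_set_open_sublocale)
  have "T = \<Squnion>\<^bsub>Sl_frame L\<^esub>?\<S>"
    unfolding L.sup_Sl_frame[OF sub] using L.sublocale_decomposition[OF T] by simp
  then have "g T = \<Squnion>\<^bsub>M\<^esub>(g ` ?\<S>)"
    using g sub unfolding frame_hom_def by metis
  moreover have "g ` ?\<S> = (\<lambda>u. f (L.nucleus T u) \<sqinter>\<^bsub>M\<^esub> c u) ` carrier L"
    unfolding image_image
  proof (rule image_cong[OF refl])
    fix u assume u: "u \<in> carrier L"
    have s: "L.sublocale_set (can L (L.nucleus T u))" "L.sublocale_set (L.open_sublocale u)"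
      using u TL by (auto intro: L.sublocale_set_can L.sublocale_set_open_sublocale)
    then have "g (can L (L.nucleus T u) \<sqinter>\<^bsub>Sl_frame L\<^esub> L.open_sublocale u) = g (can L (L.nucleus T u)) \<sqinter>\<^bsub>M\<^esub> g (L.open_sublocale u)"
      using g by (simp add: frame_hom_def L.carrier_Sl_frame)
    then show "g (L.sublocale_join (can L (L.nucleus T u)) (L.open_sublocale u)) = f (L.nucleus T u) \<sqinter>\<^bsub>M\<^esub> c u"
      using u TL s by (simp add: L.meet_Sl_frame g_open gf)
  qed
  ultimately show ?thesis
    by (simp add: explicit_lift_def)
qed

theorem lift_eq_explicit_lift:
  "lift L M f = restrict explicit_lift (carrier (Sl_frame L))"
  unfolding lift_def
proof (rule the_equality, intro conjI ballI)
  let ?g = "restrict explicit_lift (carrier (Sl_frame L))"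
  have e: "A \<subseteq> carrier (Sl_frame L) \<Longrightarrow> ?g ` A = explicit_lift ` A" for A
    by (intro image_cong) auto
  show "frame_hom (Sl_frame L) M ?g"
    using frame_hom_explicit_lift e unfolding frame_hom_def
    by (auto simp: L.Sl.sup_closed L.Sl.meet_closed)
  show "?g (can L u) = f u" if "u \<in> carrier L" for u
    using that by (simp add: explicit_lift_can L.carrier_Sl_frame L.sublocale_set_can)
next
  fix g
  assume g: "g \<in> extensional (carrier (Sl_frame L)) \<and> frame_hom (Sl_frame L) M g \<and>
    (\<forall>u\<in>carrier L. g (can L u) = f u)"
  show "g = restrict explicit_lift (carrier (Sl_frame L))"
    by (rule extensionalityI[of _ "carrier (Sl_frame L)"])
      (use g frame_hom_Sl_frame_unique in \<open>auto simp: L.carrier_Sl_frame\<close>)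
qed auto

end

section \<open>Regular contents on Hausdorff spaces\<close>

locale hausdorff_content =
  fixes X :: "'a topology" and l :: "'a set \<Rightarrow> real"
  assumes hausdorff: "Hausdorff_space X"
    and regular: "regular_content X l"
begin

lemma content: "content_on X l"
  using regular by (simp add: regular_content_def)

lemma content_nonneg [simp]: "compactin X C \<Longrightarrow> 0 \<le> l C"
  using content by (auto simp: content_on_def)

lemma content_mono: "\<lbrakk>compactin X C; compactin X D; C \<subseteq> D\<rbrakk> \<Longrightarrow> l C \<le> l D"
  using content by (auto simp: content_on_def)

lemma content_union_le: "\<lbrakk>compactin X C; compactin X D\<rbrakk> \<Longrightarrow> l (C \<union> D) \<le> l C + l D"
  using content by (auto simp: content_on_def)

lemma content_disjoint: "\<lbrakk>compactin X C; compactin X D; C \<inter> D = {}\<rbrakk> \<Longrightarrow> l (C \<union> D) = l C + l D"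
  using content by (auto simp: content_on_def)

lemma content_empty [simp]: "l {} = 0"
  using content_disjoint[of "{}" "{}"] by simp

lemma compactin_minus_open:
  assumes "compactin X K" "openin X U"
  shows "compactin X (K - U)"
proof -
  have "K - U = K \<inter> (topspace X - U)"
    using compactin_subset_topspace[OF assms(1)] by blast
  then show ?thesis
    using assms by (metis closedin_def closedin_topspace compact_Int_closedin openin_closedin_eq closedin_diff)
qed

lemma compactin_inter: "\<lbrakk>compactin X C; compactin X D\<rbrakk> \<Longrightarrow> compactin X (C \<inter> D)"
  using hausdorff by (simp add: compact_Int_closedin compactin_imp_closedin)

lemma openin_minus_compact: "compactin X K \<Longrightarrow> openin X (topspace X - K)"
  using hausdorff by (simp add: compactin_imp_closedin openin_diff)

lemma outer_approximation:
  assumes "compactin X K" "e > 0"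
  obtains U K' where "openin X U" "compactin X K'" "K \<subseteq> U" "U \<subseteq> K'" "l K' < l K + e"
proof -
  let ?A = "{K'. compactin X K' \<and> way_inside X K K'}"
  have "(INF K'\<in>?A. ennreal (l K')) < ennreal (l K + e)"
  proof -
    have "ennreal (l K) = (INF K'\<in>?A. ennreal (l K'))"
      using regular assms(1) unfolding regular_content_def by blast
    moreover have "ennreal (l K) < ennreal (l K + e)"
      using assms by (simp add: ennreal_less_iff)
    ultimately show ?thesis by simp
  qed
  then obtain K' where K': "compactin X K'" "way_inside X K K'" "ennreal (l K') < ennreal (l K + e)"
    unfolding INF_less_iff by blast
  then have "l K' < l K + e"
    by (simp add: ennreal_less_iff del: ennreal_plus)
  with K' show thesis
    using that by (auto simp: way_inside_def)
qed

text \<open>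
  The one use of regularity on which everything rests.  A compact \<open>K' \<supseteq> V \<supseteq> K - U\<close> of content
  close to that of \<open>K - U\<close>, with \<open>V\<close> open, cuts \<open>K\<close> into a part inside \<open>K'\<close> and the compact set \<open>K - V\<close>,
  which lies in \<open>U\<close>.
\<close>

lemma open_split:
  assumes K: "compactin X K" and U: "openin X U" and e: "e > 0"
  obtains C where "compactin X C" "C \<subseteq> K \<inter> U" "l K < l (K - U) + l C + e"
proof -
  have KU: "compactin X (K - U)"
    using K U by (rule compactin_minus_open)
  obtain V K' where V: "openin X V" "compactin X K'" "K - U \<subseteq> V" "V \<subseteq> K'" "l K' < l (K - U) + e"
    using outer_approximation[OF KU e] .
  have C: "compactin X (K - V)"
    using K V(1) by (rule compactin_minus_open)
  have "l K \<le> l (K' \<union> (K - V))"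
    using K V C by (intro content_mono compactin_Un) auto
  also have "\<dots> \<le> l K' + l (K - V)"
    using V C by (intro content_union_le)
  finally show thesis
    using V C by (intro that[of "K - V"]) auto
qed

text \<open>
  Split both \<open>C \<union> D\<close> and \<open>C\<close> along the complement of \<open>D\<close>: the parts outside \<open>D\<close> coincide, while the parts
  inside are \<open>D\<close> and \<open>C \<inter> D\<close>.
\<close>

lemma modular:
  assumes C: "compactin X C" and D: "compactin X D"
  shows "l (C \<union> D) + l (C \<inter> D) = l C + l D"
proof -
  let ?U = "topspace X - D"
  have U: "openin X ?U" using D by (rule openin_minus_compact)
  have CT: "C \<subseteq> topspace X" and DT: "D \<subseteq> topspace X"
    using C D by (simp_all add: compactin_subset_topspace)
  have CD: "compactin X (C \<union> D)" "compactin X (C \<inter> D)"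
    using C D by (simp_all add: compactin_Un compactin_inter)
  have "l (C \<union> D) + l (C \<inter> D) \<le> l C + l D + e" if e: "e > 0" for e
  proof -
    obtain B where B: "compactin X B" "B \<subseteq> (C \<union> D) \<inter> ?U" "l (C \<union> D) < l ((C \<union> D) - ?U) + l B + e"
      using open_split[OF CD(1) U e] .
    have "(C \<union> D) - ?U = D"
      using CT DT by auto
    moreover have "l B + l (C \<inter> D) \<le> l C"
    proof -
      have "l (B \<union> (C \<inter> D)) \<le> l C"
        using B C CD by (intro content_mono compactin_Un) auto
      moreover have "l (B \<union> (C \<inter> D)) = l B + l (C \<inter> D)"
        using B CD by (intro content_disjoint) auto
      ultimately show ?thesis by simp
    qed
    ultimately show ?thesis
      using B(3) by simp
  qed
  moreover have "l C + l D \<le> l (C \<union> D) + l (C \<inter> D) + e" if e: "e > 0" for e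
  proof -
    obtain B where B: "compactin X B" "B \<subseteq> C \<inter> ?U" "l C < l (C - ?U) + l B + e"
      using open_split[OF C U e] .
    have "C - ?U = C \<inter> D"
      using CT by auto
    moreover have "l B + l D \<le> l (C \<union> D)"
    proof -
      have "l (B \<union> D) \<le> l (C \<union> D)"
        using B C D CD by (intro content_mono compactin_Un) auto
      moreover have "l (B \<union> D) = l B + l D"
        using B D by (intro content_disjoint) auto
      ultimately show ?thesis by simp
    qed
    ultimately show ?thesis
      using B(3) by simp
  qed
  ultimately show ?thesis
    by (meson field_le_epsilon order_antisym)
qed

text \<open>
  Three consequences of modularity for the error \<open>l K - l C\<close> made when \<open>K\<close> is replaced by a compact
  subset: errors add up under unions and intersections, and do not grow under restriction.
\<close>

lemma deficit_union:
  assumes "compactin X C" "compactin X D" "compactin X c" "compactin X d" "c \<subseteq> C" "d \<subseteq> D"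
  shows "l (C \<union> D) - l (c \<union> d) \<le> (l C - l c) + (l D - l d)"
proof -
  have one: "l (C \<union> D) - l (c \<union> D) \<le> l C - l c"
    if "compactin X C" "compactin X D" "compactin X c" "c \<subseteq> C" for C D c
  proof -
    have "l (C \<union> (c \<union> D)) + l (C \<inter> (c \<union> D)) = l C + l (c \<union> D)"
      using that by (intro modular compactin_Un)
    moreover have "C \<union> (c \<union> D) = C \<union> D"
      using that by auto
    moreover have "l c \<le> l (C \<inter> (c \<union> D))"
      using that by (intro content_mono compactin_inter compactin_Un) auto
    ultimately show ?thesis by simp
  qed
  show ?thesis
    using one[of C D c] one[of D c d] assms by (simp add: Un_commute)
qed

lemma deficit_inter:
  assumes "compactin X K" "compactin X C" "compactin X D" "C \<subseteq> K" "D \<subseteq> K"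
  shows "l K - l (C \<inter> D) \<le> (l K - l C) + (l K - l D)"
proof -
  have "l (C \<union> D) \<le> l K"
    using assms by (intro content_mono compactin_Un) auto
  then show ?thesis
    using modular[of C D] assms by simp
qed

lemma deficit_restrict:
  assumes "compactin X K" "compactin X K'" "compactin X C" "K' \<subseteq> K" "C \<subseteq> K"
  shows "l K' - l (C \<inter> K') \<le> l K - l C"
  using modular[of C K'] content_mono[of "C \<union> K'" K] assms by (simp add: compactin_Un)

end

section \<open>The frame of content ideals\<close>

context hausdorff_content
begin

definition compact_downset :: "'a set set \<Rightarrow> bool" where
  "compact_downset \<D> \<longleftrightarrow> (\<forall>K\<in>\<D>. compactin X K) \<and> (\<forall>K\<in>\<D>. \<forall>C. compactin X C \<and> C \<subseteq> K \<longrightarrow> C \<in> \<D>)"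

text \<open>
  Membership in the content ideal generated by \<open>\<D>\<close>, made explicit: a single round of approximation by
  finite unions of members of \<open>\<D>\<close> already yields an ideal.
\<close>

definition approximable :: "'a set set \<Rightarrow> 'a set \<Rightarrow> bool" where
  "approximable \<D> K \<longleftrightarrow> compactin X K \<and>
     (\<forall>\<epsilon>>0. \<exists>F\<subseteq>\<D>. finite F \<and> \<Union>F \<subseteq> K \<and> l K - l (\<Union>F) < \<epsilon>)"

lemma compact_downsetI:
  assumes "\<And>K. K \<in> \<D> \<Longrightarrow> compactin X K"
    and "\<And>K C. \<lbrakk>K \<in> \<D>; compactin X C; C \<subseteq> K\<rbrakk> \<Longrightarrow> C \<in> \<D>"
  shows "compact_downset \<D>"
  unfolding compact_downset_def using assms by blast

lemma compact_downsetD: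
  assumes "compact_downset \<D>" "K \<in> \<D>"
  shows "compactin X K" and "\<lbrakk>compactin X C; C \<subseteq> K\<rbrakk> \<Longrightarrow> C \<in> \<D>"
  using assms unfolding compact_downset_def by blast+

lemma approximableI:
  assumes "compactin X K"
    and "\<And>\<epsilon>. \<epsilon> > 0 \<Longrightarrow> \<exists>F\<subseteq>\<D>. finite F \<and> \<Union>F \<subseteq> K \<and> l K - l (\<Union>F) < \<epsilon>"
  shows "approximable \<D> K"
  using assms by (simp add: approximable_def)

lemma approximableE:
  assumes "approximable \<D> K" "\<epsilon> > 0"
  obtains F where "F \<subseteq> \<D>" "finite F" "\<Union>F \<subseteq> K" "l K - l (\<Union>F) < \<epsilon>"
proof -
  have "\<exists>F\<subseteq>\<D>. finite F \<and> \<Union>F \<subseteq> K \<and> l K - l (\<Union>F) < \<epsilon>"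
    using assms by (simp add: approximable_def)
  then show thesis
    using that by (elim exE conjE)
qed

lemma approximable_compactin: "approximable \<D> K \<Longrightarrow> compactin X K"
  by (simp add: approximable_def)

lemma compact_downset_Union:
  "\<lbrakk>compact_downset \<D>; F \<subseteq> \<D>; finite F\<rbrakk> \<Longrightarrow> compactin X (\<Union>F)"
  by (intro compactin_Union) (auto intro: compact_downsetD(1))

lemma content_idealD:
  assumes "content_ideal X l U"
  shows "K \<in> U \<Longrightarrow> compactin X K"
    and "\<lbrakk>K \<in> U; compactin X C; C \<subseteq> K\<rbrakk> \<Longrightarrow> C \<in> U"
    and "\<lbrakk>compactin X K; \<C> \<subseteq> U; \<And>C. C \<in> \<C> \<Longrightarrow> C \<subseteq> K; \<And>\<epsilon>. \<epsilon> > 0 \<Longrightarrow> \<exists>F\<subseteq>\<C>. finite F \<and> l K - l (\<Union>F) < \<epsilon>\<rbrakk> \<Longrightarrow> K \<in> U"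
proof -
  have 1: "\<forall>K\<in>U. compactin X K" and 2: "\<forall>K\<in>U. \<forall>C. compactin X C \<and> C \<subseteq> K \<longrightarrow> C \<in> U"
    and 3: "\<And>K \<C>. compactin X K \<and> \<C> \<subseteq> U \<and> (\<forall>C\<in>\<C>. C \<subseteq> K) \<and>
        (\<forall>\<epsilon>>0. \<exists>F\<subseteq>\<C>. finite F \<and> l K - l (\<Union>F) < \<epsilon>) \<Longrightarrow> K \<in> U"
    using assms unfolding content_ideal_def by metis+
  show "K \<in> U \<Longrightarrow> compactin X K"
    using 1 by blast
  show "\<lbrakk>K \<in> U; compactin X C; C \<subseteq> K\<rbrakk> \<Longrightarrow> C \<in> U"
    using 2 by blast
  show "\<lbrakk>compactin X K; \<C> \<subseteq> U; \<And>C. C \<in> \<C> \<Longrightarrow> C \<subseteq> K; \<And>\<epsilon>. \<epsilon> > 0 \<Longrightarrow> \<exists>F\<subseteq>\<C>. finite F \<and> l K - l (\<Union>F) < \<epsilon>\<rbrakk> \<Longrightarrow> K \<in> U"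
    by (intro 3 conjI ballI allI impI)
qed

lemma approximable_mono:
  assumes "\<D> \<subseteq> \<E>" "approximable \<D> K"
  shows "approximable \<E> K"
proof (rule approximableI)
  show "compactin X K"
    using assms(2) by (rule approximable_compactin)
  fix \<epsilon> :: real assume "\<epsilon> > 0"
  with assms(2) obtain F where "F \<subseteq> \<D>" "finite F" "\<Union>F \<subseteq> K" "l K - l (\<Union>F) < \<epsilon>"
    by (rule approximableE)
  then show "\<exists>F\<subseteq>\<E>. finite F \<and> \<Union>F \<subseteq> K \<and> l K - l (\<Union>F) < \<epsilon>"
    using assms(1) by (intro exI[of _ F]) simp
qed

lemma approximable_imp_mem:
  assumes U: "content_ideal X l U" and K: "approximable U K"
  shows "K \<in> U"
proof (rule content_idealD(3)[OF U, of K "{C \<in> U. C \<subseteq> K}"])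
  fix \<epsilon> :: real assume "\<epsilon> > 0"
  with K obtain F where "F \<subseteq> U" "finite F" "\<Union>F \<subseteq> K" "l K - l (\<Union>F) < \<epsilon>"
    by (rule approximableE)
  then show "\<exists>F\<subseteq>{C \<in> U. C \<subseteq> K}. finite F \<and> l K - l (\<Union>F) < \<epsilon>"
    by (intro exI[of _ F]) auto
qed (use approximable_compactin[OF K] in auto)

lemma mem_approximable:
  assumes "compact_downset \<D>" "K \<in> \<D>"
  shows "approximable \<D> K"
proof (rule approximableI)
  show "compactin X K"
    using assms by (rule compact_downsetD)
  show "\<exists>F\<subseteq>\<D>. finite F \<and> \<Union>F \<subseteq> K \<and> l K - l (\<Union>F) < \<epsilon>" if "\<epsilon> > 0" for \<epsilon>
    using that assms(2) by (intro exI[of _ "{K}"]) simp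
qed

lemma approximable_Un:
  assumes \<D>: "compact_downset \<D>" and C: "approximable \<D> C" and D: "approximable \<D> D"
  shows "approximable \<D> (C \<union> D)"
proof (rule approximableI)
  have CD: "compactin X C" "compactin X D"
    using C D by (simp_all add: approximable_compactin)
  then show "compactin X (C \<union> D)" by (rule compactin_Un)
  fix \<epsilon> :: real assume "\<epsilon> > 0"
  then have e: "\<epsilon> / 2 > 0" by simp
  obtain F where F: "F \<subseteq> \<D>" "finite F" "\<Union>F \<subseteq> C" "l C - l (\<Union>F) < \<epsilon> / 2"
    using approximableE[OF C e] .
  obtain G where G: "G \<subseteq> \<D>" "finite G" "\<Union>G \<subseteq> D" "l D - l (\<Union>G) < \<epsilon> / 2"
    using approximableE[OF D e] .
  have "l (C \<union> D) - l (\<Union>F \<union> \<Union>G) < \<epsilon>"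
    using deficit_union[OF CD compact_downset_Union[OF \<D> F(1,2)] compact_downset_Union[OF \<D> G(1,2)] F(3) G(3)]
      F(4) G(4) by simp
  then show "\<exists>F\<subseteq>\<D>. finite F \<and> \<Union>F \<subseteq> C \<union> D \<and> l (C \<union> D) - l (\<Union>F) < \<epsilon>"
    using F G by (intro exI[of _ "F \<union> G"]) auto
qed

lemma approximable_empty: "approximable \<D> {}"
  by (rule approximableI) (simp, intro exI[of _ "{}"], simp)

lemma approximable_Union:
  assumes "compact_downset \<D>" "finite F" "\<And>C. C \<in> F \<Longrightarrow> approximable \<D> C"
  shows "approximable \<D> (\<Union>F)"
  using assms(2,3) by (induction F) (auto intro: approximable_empty approximable_Un[OF assms(1)])

lemma approximable_downward:
  assumes \<D>: "compact_downset \<D>" and K: "approximable \<D> K" and C: "compactin X C" "C \<subseteq> K"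
  shows "approximable \<D> C"
proof (rule approximableI)
  show "compactin X C" by fact
  fix \<epsilon> :: real assume "\<epsilon> > 0"
  with K obtain F where F: "F \<subseteq> \<D>" "finite F" "\<Union>F \<subseteq> K" "l K - l (\<Union>F) < \<epsilon>"
    by (rule approximableE)
  \<comment> \<open>Intersecting the approximating family with \<open>C\<close> does not increase the error.\<close>
  let ?G = "(\<lambda>D. D \<inter> C) ` F"
  have U: "\<Union>?G = \<Union>F \<inter> C" by auto
  have "?G \<subseteq> \<D>"
  proof (rule image_subsetI)
    fix D assume "D \<in> F"
    then have "D \<in> \<D>" using F(1) by blast
    note D = compact_downsetD[OF \<D> this]
    show "D \<inter> C \<in> \<D>"
      by (rule D(2)[OF compactin_inter[OF D(1) C(1)] Int_lower1])
  qed
  moreover have "l C - l (\<Union>F \<inter> C) < \<epsilon>"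
    using deficit_restrict[OF _ C(1) compact_downset_Union[OF \<D> F(1,2)] C(2) F(3)]
      approximable_compactin[OF K] F(4) by simp
  ultimately show "\<exists>F\<subseteq>\<D>. finite F \<and> \<Union>F \<subseteq> C \<and> l C - l (\<Union>F) < \<epsilon>"
    using F(2) U by (intro exI[of _ ?G]) auto
qed

lemma approximable_limit:
  assumes \<D>: "compact_downset \<D>" and K: "compactin X K"
    and lim: "\<And>\<epsilon>. \<epsilon> > 0 \<Longrightarrow> \<exists>E. approximable \<D> E \<and> E \<subseteq> K \<and> l K - l E < \<epsilon>"
  shows "approximable \<D> K"
proof (rule approximableI)
  fix \<epsilon> :: real assume "\<epsilon> > 0"
  then have e: "\<epsilon> / 2 > 0" by simp
  obtain E where E: "approximable \<D> E" "E \<subseteq> K" "l K - l E < \<epsilon> / 2"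
    using lim[OF e] by blast
  obtain F where F: "F \<subseteq> \<D>" "finite F" "\<Union>F \<subseteq> E" "l E - l (\<Union>F) < \<epsilon> / 2"
    using approximableE[OF E(1) e] .
  then show "\<exists>F\<subseteq>\<D>. finite F \<and> \<Union>F \<subseteq> K \<and> l K - l (\<Union>F) < \<epsilon>"
    using E by (intro exI[of _ F]) auto
qed fact

text \<open>
  Closure under the covering condition holds because approximability passes to finite unions and errors
  in successive approximations add up.
\<close>

lemma content_ideal_approximable:
  assumes \<D>: "compact_downset \<D>"
  shows "content_ideal X l {K. approximable \<D> K}"
  unfolding content_ideal_def
proof (intro conjI allI ballI impI)
  show "\<And>K. K \<in> {K. approximable \<D> K} \<Longrightarrow> compactin X K"
    by (simp add: approximable_compactin)
  show "C \<in> {K. approximable \<D> K}" if "K \<in> {K. approximable \<D> K}" "compactin X C \<and> C \<subseteq> K" for K C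
    using that approximable_downward[OF \<D>] by auto
  fix K \<C>
  assume *: "compactin X K \<and> \<C> \<subseteq> {K. approximable \<D> K} \<and> (\<forall>C\<in>\<C>. C \<subseteq> K) \<and>
    (\<forall>\<epsilon>>0. \<exists>F\<subseteq>\<C>. finite F \<and> l K - l (\<Union>F) < \<epsilon>)"
  have "\<exists>E. approximable \<D> E \<and> E \<subseteq> K \<and> l K - l E < \<epsilon>" if e: "\<epsilon> > 0" for \<epsilon>
  proof -
    obtain F where F: "F \<subseteq> \<C>" "finite F" "l K - l (\<Union>F) < \<epsilon>"
      using * e by blast
    then have "approximable \<D> (\<Union>F)"
      using * by (intro approximable_Union[OF \<D>]) auto
    then show ?thesis
      using F * by (intro exI[of _ "\<Union>F"]) auto
  qed
  then show "K \<in> {K. approximable \<D> K}"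
    using * by (auto intro!: approximable_limit[OF \<D>])
qed

lemma content_ideal_hull:
  assumes \<D>: "compact_downset \<D>"
  shows "content_ideal X l hull \<D> = {K. approximable \<D> K}"
proof (rule hull_unique)
  show "\<D> \<subseteq> {K. approximable \<D> K}"
    using mem_approximable[OF \<D>] by blast
  show "content_ideal X l {K. approximable \<D> K}"
    using \<D> by (rule content_ideal_approximable)
  show "{K. approximable \<D> K} \<subseteq> U" if "\<D> \<subseteq> U" "content_ideal X l U" for U
    using that approximable_mono[OF that(1)] approximable_imp_mem by blast
qed

lemma content_ideal_inter:
  assumes "content_ideal X l U" "content_ideal X l V"
  shows "content_ideal X l (U \<inter> V)"
  unfolding content_ideal_def
proof (intro conjI allI impI ballI)
  show "\<And>K. K \<in> U \<inter> V \<Longrightarrow> compactin X K"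
    using content_idealD(1)[OF assms(1)] by blast
  show "\<And>K C. \<lbrakk>K \<in> U \<inter> V; compactin X C \<and> C \<subseteq> K\<rbrakk> \<Longrightarrow> C \<in> U \<inter> V"
    using content_idealD(2)[OF assms(1)] content_idealD(2)[OF assms(2)] by blast
  fix K \<C>
  assume *: "compactin X K \<and> \<C> \<subseteq> U \<inter> V \<and> (\<forall>C\<in>\<C>. C \<subseteq> K) \<and>
    (\<forall>\<epsilon>>0. \<exists>F\<subseteq>\<C>. finite F \<and> l K - l (\<Union>F) < \<epsilon>)"
  have "K \<in> U"
    by (rule content_idealD(3)[OF assms(1), of K \<C>]) (use * in blast)+
  moreover have "K \<in> V"
    by (rule content_idealD(3)[OF assms(2), of K \<C>]) (use * in blast)+
  ultimately show "K \<in> U \<inter> V" by simp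
qed

lemma carrier_content_locale: "carrier (content_locale X l) = {U. content_ideal X l U}"
  and le_content_locale: "U \<sqsubseteq>\<^bsub>content_locale X l\<^esub> V \<longleftrightarrow> U \<subseteq> V"
  by (simp_all add: content_locale_def set_order_def)

lemma partial_order_content_locale: "partial_order (content_locale X l)"
  by unfold_locales (auto simp: content_locale_def set_order_def)

lemma compact_downset_Union_ideals:
  "\<A> \<subseteq> {U. content_ideal X l U} \<Longrightarrow> compact_downset (\<Union>\<A>)"
  by (rule compact_downsetI) (blast intro: content_idealD)+

text \<open>
  Distributivity is where the explicit description of generated ideals pays off: a finite family that
  approximates \<open>K \<in> V\<close> consists of subsets of \<open>K\<close>, so it lies in \<open>V\<close> as well.
\<close>

lemma
  shows frame_content_locale: "frame (content_locale X l)"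
    and sup_content_locale: "\<A> \<subseteq> carrier (content_locale X l) \<Longrightarrow>
      \<Squnion>\<^bsub>content_locale X l\<^esub>\<A> = {K. approximable (\<Union>\<A>) K}"
    and meet_content_locale: "\<lbrakk>content_ideal X l U; content_ideal X l V\<rbrakk> \<Longrightarrow>
      U \<sqinter>\<^bsub>content_locale X l\<^esub> V = U \<inter> V"
proof -
  let ?L = "content_locale X l"
  let ?C = "carrier ?L" and ?s = "\<lambda>\<A>. {K. approximable (\<Union>\<A>) K}"
  note carrier_content_locale [simp] le_content_locale [simp]
  have 1: "?s \<A> \<in> ?C" if "\<A> \<subseteq> ?C" for \<A>
    using that by (simp add: content_ideal_approximable compact_downset_Union_ideals)
  have 2: "U \<sqsubseteq>\<^bsub>?L\<^esub> ?s \<A>" if "\<A> \<subseteq> ?C" "U \<in> \<A>" for U \<A>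
    using that mem_approximable[of "\<Union>\<A>"] by (auto simp: compact_downset_Union_ideals)
  have 3: "?s \<A> \<sqsubseteq>\<^bsub>?L\<^esub> V" if "\<A> \<subseteq> ?C" "V \<in> ?C" "\<And>U. U \<in> \<A> \<Longrightarrow> U \<sqsubseteq>\<^bsub>?L\<^esub> V" for V \<A>
  proof -
    have "\<Union>\<A> \<subseteq> V" using that by auto
    then show ?thesis
      using that(2) approximable_mono approximable_imp_mem by fastforce
  qed
  have 4: "U \<inter> V \<in> ?C" if "U \<in> ?C" "V \<in> ?C" for U V
    using that by (simp add: content_ideal_inter)
  have 5: "U \<inter> V \<sqsubseteq>\<^bsub>?L\<^esub> U" "U \<inter> V \<sqsubseteq>\<^bsub>?L\<^esub> V" if "U \<in> ?C" "V \<in> ?C" for U V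
    by auto
  have 6: "W \<sqsubseteq>\<^bsub>?L\<^esub> U \<inter> V" if "U \<in> ?C" "V \<in> ?C" "W \<in> ?C" "W \<sqsubseteq>\<^bsub>?L\<^esub> U" "W \<sqsubseteq>\<^bsub>?L\<^esub> V" for U V W
    using that by auto
  have 7: "V \<inter> ?s \<A> \<sqsubseteq>\<^bsub>?L\<^esub> ?s ((\<inter>) V ` \<A>)" if V: "V \<in> ?C" and \<A>: "\<A> \<subseteq> ?C" for V \<A>
  proof -
    have "approximable (\<Union>((\<inter>) V ` \<A>)) K" if K: "K \<in> V" "approximable (\<Union>\<A>) K" for K
    proof (rule approximableI)
      show "compactin X K" using K by (simp add: approximable_compactin)
      fix \<epsilon> :: real assume "\<epsilon> > 0"
      with K(2) obtain F where F: "F \<subseteq> \<Union>\<A>" "finite F" "\<Union>F \<subseteq> K" "l K - l (\<Union>F) < \<epsilon>"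
        by (rule approximableE)
      have "F \<subseteq> V"
      proof
        fix C assume C: "C \<in> F"
        then have "compactin X C"
          using F(1) \<A> content_idealD(1) by auto
        then show "C \<in> V"
          using V K(1) C F(3) content_idealD(2)[of V K C] by auto
      qed
      then show "\<exists>F\<subseteq>\<Union>((\<inter>) V ` \<A>). finite F \<and> \<Union>F \<subseteq> K \<and> l K - l (\<Union>F) < \<epsilon>"
        using F by (intro exI[of _ F]) auto
    qed
    then show ?thesis by auto
  qed
  note * = frame_explicit[where m = "(\<inter>)" and s = ?s, OF partial_order_content_locale 1 2 3 4 5 6 7]
  show "frame ?L"
    by (rule *(1))
  show "\<A> \<subseteq> ?C \<Longrightarrow> \<Squnion>\<^bsub>?L\<^esub>\<A> = ?s \<A>"
    by (rule *(2))
  show "\<lbrakk>content_ideal X l U; content_ideal X l V\<rbrakk> \<Longrightarrow> U \<sqinter>\<^bsub>?L\<^esub> V = U \<inter> V"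
    by (rule *(3)) simp_all
qed

end

section \<open>The content ideal of a subset\<close>

context hausdorff_content
begin

text \<open>
  The ideal attached to an arbitrary subset \<open>S\<close>, extending the inverse image map of \<open>p\<^sub>\<lambda>\<close> from open sets.
  It plays the role of the open part of the content locale cut out by \<open>S\<close>.
\<close>

definition inner_ideal :: "'a set \<Rightarrow> 'a set set" where
  "inner_ideal S = content_ideal X l hull {K. compactin X K \<and> K \<subseteq> S}"

lemma compact_downset_subsets: "compact_downset {K. compactin X K \<and> K \<subseteq> S}"
  by (auto simp: compact_downset_def)

lemma content_ideal_inner_ideal: "content_ideal X l (inner_ideal S)"
  unfolding inner_ideal_def
  by (simp add: content_ideal_hull content_ideal_approximable compact_downset_subsets)

lemma inner_ideal_iff:
  "K \<in> inner_ideal S \<longleftrightarrow> compactin X K \<and> (\<forall>\<epsilon>>0. \<exists>C. compactin X C \<and> C \<subseteq> K \<inter> S \<and> l K - l C < \<epsilon>)"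
    (is "_ \<longleftrightarrow> ?R")
proof
  let ?D = "{K. compactin X K \<and> K \<subseteq> S}"
  assume "K \<in> inner_ideal S"
  then have K: "approximable ?D K"
    by (simp add: inner_ideal_def content_ideal_hull compact_downset_subsets)
  have "\<exists>C. compactin X C \<and> C \<subseteq> K \<inter> S \<and> l K - l C < \<epsilon>" if e: "\<epsilon> > 0" for \<epsilon>
  proof -
    obtain F where "F \<subseteq> ?D" "finite F" "\<Union>F \<subseteq> K" "l K - l (\<Union>F) < \<epsilon>"
      using approximableE[OF K e] .
    then show ?thesis
      using compact_downset_Union[OF compact_downset_subsets, of F S]
      by (intro exI[of _ "\<Union>F"]) auto
  qed
  then show ?R
    using approximable_compactin[OF K] by blast
next
  assume R: ?R
  have "approximable {K. compactin X K \<and> K \<subseteq> S} K"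
  proof (rule approximable_limit[OF compact_downset_subsets])
    fix \<epsilon> :: real assume "\<epsilon> > 0"
    then obtain C where "compactin X C" "C \<subseteq> K \<inter> S" "l K - l C < \<epsilon>"
      using R by blast
    then show "\<exists>E. approximable {K. compactin X K \<and> K \<subseteq> S} E \<and> E \<subseteq> K \<and> l K - l E < \<epsilon>"
      by (intro exI[of _ C]) (auto intro!: mem_approximable compact_downset_subsets)
  qed (use R in simp)
  then show "K \<in> inner_ideal S"
    by (simp add: inner_ideal_def content_ideal_hull compact_downset_subsets)
qed

lemma inner_idealE:
  assumes "K \<in> inner_ideal S" "\<epsilon> > 0"
  obtains C where "compactin X C" "C \<subseteq> K \<inter> S" "l K - l C < \<epsilon>"
proof -
  have "\<exists>C. compactin X C \<and> C \<subseteq> K \<inter> S \<and> l K - l C < \<epsilon>"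
    using assms by (simp add: inner_ideal_iff)
  then show thesis
    using that by (elim exE conjE)
qed

lemma inner_ideal_memI: "\<lbrakk>compactin X K; K \<subseteq> S\<rbrakk> \<Longrightarrow> K \<in> inner_ideal S"
  unfolding inner_ideal_iff by (auto intro!: exI[of _ K])

lemma inner_ideal_mono: "S \<subseteq> T \<Longrightarrow> inner_ideal S \<subseteq> inner_ideal T"
  unfolding inner_ideal_def by (intro hull_mono) auto

lemma inner_ideal_inter: "inner_ideal S \<inter> inner_ideal T = inner_ideal (S \<inter> T)"
proof
  show "inner_ideal (S \<inter> T) \<subseteq> inner_ideal S \<inter> inner_ideal T"
    by (simp add: inner_ideal_mono)
  show "inner_ideal S \<inter> inner_ideal T \<subseteq> inner_ideal (S \<inter> T)"
  proof
    fix K assume K: "K \<in> inner_ideal S \<inter> inner_ideal T"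
    then have cK: "compactin X K" by (simp add: inner_ideal_iff)
    have "\<exists>E. compactin X E \<and> E \<subseteq> K \<inter> (S \<inter> T) \<and> l K - l E < \<epsilon>" if "\<epsilon> > 0" for \<epsilon>
    proof -
      have e: "\<epsilon> / 2 > 0" using that by simp
      obtain C where C: "compactin X C" "C \<subseteq> K \<inter> S" "l K - l C < \<epsilon> / 2"
        using inner_idealE[OF IntD1[OF K] e] .
      obtain D where D: "compactin X D" "D \<subseteq> K \<inter> T" "l K - l D < \<epsilon> / 2"
        using inner_idealE[OF IntD2[OF K] e] .
      show ?thesis
        using deficit_inter[of K C D] C D cK
        by (intro exI[of _ "C \<inter> D"]) (auto intro: compactin_inter)
    qed
    then show "K \<in> inner_ideal (S \<inter> T)"
      using cK by (simp add: inner_ideal_iff)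
  qed
qed

text \<open>
  Members of \<open>inner_ideal S\<close> are approximated in content by compact subsets of \<open>S\<close>, so enlarging the
  family of these subsets to the ideal does not change the supremum.
\<close>

lemma inner_measure_inner_ideal:
  "inner_measure l (inner_ideal S) = (SUP K\<in>{K. compactin X K \<and> K \<subseteq> S}. ennreal (l K))"
  unfolding inner_measure_def
proof (rule antisym)
  let ?D = "{K. compactin X K \<and> K \<subseteq> S}"
  show "(SUP K\<in>?D. ennreal (l K)) \<le> (SUP K\<in>inner_ideal S. ennreal (l K))"
    by (intro SUP_subset_mono) (auto intro: inner_ideal_memI)
  show "(SUP K\<in>inner_ideal S. ennreal (l K)) \<le> (SUP K\<in>?D. ennreal (l K))"
  proof (rule SUP_least)
    fix K assume K: "K \<in> inner_ideal S"
    show "ennreal (l K) \<le> (SUP K\<in>?D. ennreal (l K))"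
    proof (rule ennreal_le_epsilon)
      fix e :: real assume "e > 0"
      with K obtain C where C: "compactin X C" "C \<subseteq> K \<inter> S" "l K - l C < e"
        by (rule inner_idealE)
      have "ennreal (l K) \<le> ennreal (l C + e)"
        using C by (intro ennreal_leI) simp
      also have "\<dots> = ennreal (l C) + ennreal e"
        using C \<open>e > 0\<close> by simp
      also have "\<dots> \<le> (SUP K\<in>?D. ennreal (l K)) + ennreal e"
        using C by (intro add_right_mono SUP_upper) auto
      finally show "ennreal (l K) \<le> (SUP K\<in>?D. ennreal (l K)) + ennreal e" .
    qed
  qed
qed

lemma top_content_locale: "\<top>\<^bsub>content_locale X l\<^esub> = {K. compactin X K}"
proof -
  interpret frame "content_locale X l" by (rule frame_content_locale)
  show ?thesis
  proof (rule top_equality)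
    show "{K. compactin X K} \<in> carrier (content_locale X l)"
      by (simp add: carrier_content_locale content_ideal_def)
    show "U \<sqsubseteq>\<^bsub>content_locale X l\<^esub> {K. compactin X K}" if "U \<in> carrier (content_locale X l)" for U
      using that content_idealD(1)[of U] by (auto simp: carrier_content_locale le_content_locale)
  qed
qed

lemma inner_ideal_empty: "inner_ideal {} = {K. compactin X K \<and> l K = 0}"
proof (rule Set.set_eqI)
  fix K
  have "(\<forall>\<epsilon>>0. l K < \<epsilon>) \<longleftrightarrow> l K = 0" if "compactin X K"
    using content_nonneg[OF that] by (metis less_irrefl order.order_iff_strict)
  then show "K \<in> inner_ideal {} \<longleftrightarrow> K \<in> {K. compactin X K \<and> l K = 0}"
    by (auto simp: inner_ideal_iff)
qed

lemma bottom_content_locale: "\<bottom>\<^bsub>content_locale X l\<^esub> = inner_ideal {}"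
proof -
  interpret frame "content_locale X l" by (rule frame_content_locale)
  show ?thesis
  proof (rule bottom_equality)
    show "inner_ideal {} \<in> carrier (content_locale X l)"
      by (simp add: carrier_content_locale content_ideal_inner_ideal)
    show "inner_ideal {} \<sqsubseteq>\<^bsub>content_locale X l\<^esub> U" if "U \<in> carrier (content_locale X l)" for U
    proof -
      have "K \<in> U" if "compactin X K" "l K = 0" for K
      proof (rule approximable_imp_mem)
        show "content_ideal X l U"
          using \<open>U \<in> _\<close> by (simp add: carrier_content_locale)
        show "approximable U K"
          by (rule approximableI[OF that(1)], intro exI[of _ "{}"]) (simp add: that(2))
      qed
      then show ?thesis
        by (auto simp: le_content_locale inner_ideal_empty)
    qed
  qed
qed

text \<open>
  To recognise members of an ideal containing \<open>inner_ideal U\<close>, the part inside an open set \<open>U\<close> may be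
  discarded: by \<open>open_split\<close>, \<open>K\<close> is approximated by the disjoint union of \<open>K - U\<close> and a compact
  subset of \<open>U\<close>.
\<close>

lemma mem_ideal_of_split:
  assumes J: "content_ideal X l J" and U: "openin X U" "inner_ideal U \<subseteq> J"
    and K: "compactin X K" "K - U \<in> J"
  shows "K \<in> J"
proof (rule approximable_imp_mem[OF J])
  show "approximable J K"
  proof (rule approximableI)
    fix \<epsilon> :: real assume "\<epsilon> > 0"
    then obtain C where C: "compactin X C" "C \<subseteq> K \<inter> U" "l K < l (K - U) + l C + \<epsilon>"
      using open_split[OF K(1) U(1)] by blast
    then have "C \<in> J"
      using U(2) inner_ideal_memI[of C U] by auto
    moreover have "l ((K - U) \<union> C) = l (K - U) + l C"
      using C K U by (intro content_disjoint compactin_minus_open) auto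
    ultimately show "\<exists>F\<subseteq>J. finite F \<and> \<Union>F \<subseteq> K \<and> l K - l (\<Union>F) < \<epsilon>"
      using C K by (intro exI[of _ "{K - U, C}"]) auto
  qed fact
qed

text \<open>
  A compact subset of \<open>\<Union>\<U>\<close> is covered by finitely many members, which are discarded one after the other.
\<close>

lemma inner_ideal_Union_le:
  assumes J: "content_ideal X l J"
    and \<U>: "\<And>U. U \<in> \<U> \<Longrightarrow> openin X U \<and> inner_ideal U \<subseteq> J"
  shows "inner_ideal (\<Union>\<U>) \<subseteq> J"
proof -
  have fin: "K \<in> J" if "finite F" "F \<subseteq> \<U>" "compactin X K" "K \<subseteq> \<Union>F" for F K
    using that
  proof (induction F arbitrary: K)
    case empty
    then show ?case
      by (auto intro!: approximable_imp_mem[OF J] approximable_empty)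
  next
    case (insert U F)
    have U: "openin X U" "inner_ideal U \<subseteq> J"
      using \<U>[of U] insert.prems(1) by simp_all
    have "F \<subseteq> \<U>" "K - U \<subseteq> \<Union>F"
      using insert.prems by auto
    then have "K - U \<in> J"
      using compactin_minus_open[OF insert.prems(2) U(1)] by (intro insert.IH)
    then show ?case
      by (rule mem_ideal_of_split[OF J U insert.prems(2)])
  qed
  have "{K. compactin X K \<and> K \<subseteq> \<Union>\<U>} \<subseteq> J"
  proof clarify
    fix K assume K: "compactin X K" "K \<subseteq> \<Union>\<U>"
    moreover have "\<forall>U\<in>\<U>. openin X U"
      using \<U> by blast
    ultimately obtain F where "finite F" "F \<subseteq> \<U>" "K \<subseteq> \<Union>F"
      unfolding compactin_def by meson
    then show "K \<in> J"
      using K(1) by (intro fin)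
  qed
  then show ?thesis
    unfolding inner_ideal_def by (intro hull_minimal J)
qed

text \<open>
  For a compact \<open>K\<close>, the part \<open>K - U\<close> is compact, hence in the second ideal, and \<open>mem_ideal_of_split\<close>
  recovers \<open>K\<close> itself.
\<close>

lemma inner_ideal_complements:
  assumes U: "openin X U"
  shows "frame.complements (content_locale X l) (inner_ideal U) (inner_ideal (topspace X - U))"
proof -
  interpret frame "content_locale X l" by (rule frame_content_locale)
  let ?U' = "topspace X - U"
  have "inner_ideal U \<sqinter>\<^bsub>content_locale X l\<^esub> inner_ideal ?U' = inner_ideal {}"
    by (simp add: meet_content_locale content_ideal_inner_ideal inner_ideal_inter)
  moreover have "inner_ideal U \<squnion>\<^bsub>content_locale X l\<^esub> inner_ideal ?U' = {K. compactin X K}"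
  proof -
    have sub: "{inner_ideal U, inner_ideal ?U'} \<subseteq> carrier (content_locale X l)"
      by (simp add: carrier_content_locale content_ideal_inner_ideal)
    let ?J = "{K. approximable (\<Union>{inner_ideal U, inner_ideal ?U'}) K}"
    have D: "compact_downset (\<Union>{inner_ideal U, inner_ideal ?U'})"
      using sub by (intro compact_downset_Union_ideals) (simp add: carrier_content_locale)
    have J: "content_ideal X l ?J"
      using D by (rule content_ideal_approximable)
    have up: "inner_ideal U \<subseteq> ?J" "inner_ideal ?U' \<subseteq> ?J"
      using mem_approximable[OF D] by auto
    have "K \<in> ?J" if K: "compactin X K" for K
    proof (rule mem_ideal_of_split[OF J U up(1) K])
      have "K - U \<in> inner_ideal ?U'"
        using K U compactin_subset_topspace[OF K]
        by (intro inner_ideal_memI compactin_minus_open) auto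
      then show "K - U \<in> ?J" using up(2) by blast
    qed
    moreover have "K \<in> ?J \<Longrightarrow> compactin X K" for K
      by (simp add: approximable_compactin)
    ultimately show ?thesis
      unfolding join_def sup_content_locale[OF sub] by blast
  qed
  ultimately show ?thesis
    by (simp add: complements_def carrier_content_locale content_ideal_inner_ideal
        bottom_content_locale top_content_locale)
qed

end

section \<open>The frame of open sets\<close>

lemma carrier_opens: "carrier (opens X) = {U. openin X U}"
  and le_opens: "U \<sqsubseteq>\<^bsub>opens X\<^esub> V \<longleftrightarrow> U \<subseteq> V"
  by (simp_all add: opens_def set_order_def)

lemma partial_order_opens: "partial_order (opens X)"
  by unfold_locales (auto simp: opens_def set_order_def)

lemma
  shows frame_opens: "frame (opens X)"
    and sup_opens: "\<U> \<subseteq> {U. openin X U} \<Longrightarrow> \<Squnion>\<^bsub>opens X\<^esub>\<U> = \<Union>\<U>"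
    and meet_opens: "\<lbrakk>openin X U; openin X V\<rbrakk> \<Longrightarrow> U \<sqinter>\<^bsub>opens X\<^esub> V = U \<inter> V"
proof -
  note carrier_opens [simp] le_opens [simp]
  have 1: "\<Union>\<U> \<in> carrier (opens X)" if "\<U> \<subseteq> carrier (opens X)" for \<U>
    using that by auto
  have 2: "U \<sqsubseteq>\<^bsub>opens X\<^esub> \<Union>\<U>" if "\<U> \<subseteq> carrier (opens X)" "U \<in> \<U>" for \<U> U
    using that by auto
  have 3: "\<Union>\<U> \<sqsubseteq>\<^bsub>opens X\<^esub> V"
    if "\<U> \<subseteq> carrier (opens X)" "V \<in> carrier (opens X)" "\<And>U. U \<in> \<U> \<Longrightarrow> U \<sqsubseteq>\<^bsub>opens X\<^esub> V" for \<U> V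
    using that by auto
  have 4: "U \<inter> V \<in> carrier (opens X)" if "U \<in> carrier (opens X)" "V \<in> carrier (opens X)" for U V
    using that by auto
  have 5: "U \<inter> V \<sqsubseteq>\<^bsub>opens X\<^esub> U" "U \<inter> V \<sqsubseteq>\<^bsub>opens X\<^esub> V"
    if "U \<in> carrier (opens X)" "V \<in> carrier (opens X)" for U V
    by auto
  have 6: "W \<sqsubseteq>\<^bsub>opens X\<^esub> U \<inter> V"
    if "U \<in> carrier (opens X)" "V \<in> carrier (opens X)" "W \<in> carrier (opens X)"
      "W \<sqsubseteq>\<^bsub>opens X\<^esub> U" "W \<sqsubseteq>\<^bsub>opens X\<^esub> V" for U V W
    using that by auto
  have 7: "V \<inter> \<Union>\<U> \<sqsubseteq>\<^bsub>opens X\<^esub> \<Union>((\<inter>) V ` \<U>)"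
    if "V \<in> carrier (opens X)" "\<U> \<subseteq> carrier (opens X)" for V \<U>
    by auto
  note * = frame_explicit[where m = "(\<inter>)" and s = Union, OF partial_order_opens 1 2 3 4 5 6 7]
  show "frame (opens X)"
    by (rule *(1))
  show "\<U> \<subseteq> {U. openin X U} \<Longrightarrow> \<Squnion>\<^bsub>opens X\<^esub>\<U> = \<Union>\<U>"
    using *(2)[of \<U>] unfolding carrier_opens .
  show "\<lbrakk>openin X U; openin X V\<rbrakk> \<Longrightarrow> U \<sqinter>\<^bsub>opens X\<^esub> V = U \<inter> V"
    by (rule *(3)) simp_all
qed

lemma join_opens: "\<lbrakk>openin X U; openin X V\<rbrakk> \<Longrightarrow> U \<squnion>\<^bsub>opens X\<^esub> V = U \<union> V"
  unfolding join_def by (subst sup_opens) auto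

interpretation opens: ambient_frame "opens X" for X :: "'a topology"
  by (rule ambient_frame.intro) (rule frame_opens)

lemma top_opens: "\<top>\<^bsub>opens X\<^esub> = topspace X"
  by (rule opens.top_equality) (auto simp: carrier_opens le_opens openin_subset)

lemma bottom_opens: "\<bottom>\<^bsub>opens X\<^esub> = {}"
  by (rule opens.bottom_equality) (auto simp: carrier_opens le_opens)

section \<open>The sublocale of a subspace\<close>

text \<open>
  Adjointness determines a map on the carrier, and extensionality elsewhere.
\<close>

lemma right_adjoint_eq:
  assumes "partial_order L" "partial_order M" and h: "h \<in> carrier L \<rightarrow> carrier M"
    and G: "G \<in> carrier M \<rightarrow> carrier L"
    and adj: "\<And>x y. \<lbrakk>x \<in> carrier L; y \<in> carrier M\<rbrakk> \<Longrightarrow> h x \<sqsubseteq>\<^bsub>M\<^esub> y \<longleftrightarrow> x \<sqsubseteq>\<^bsub>L\<^esub> G y"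
  shows "right_adjoint L M h = restrict G (carrier M)"
  unfolding right_adjoint_def
proof (rule the_equality)
  interpret L: partial_order L by fact
  have "galois_connection \<lparr>orderA = L, orderB = M, lower = h, upper = restrict G (carrier M)\<rparr>"
    using assms by (intro galois_connection.intro connection.intro galois_connection_axioms.intro) auto
  then show "restrict G (carrier M) \<in> extensional (carrier M) \<and>
      galois_connection \<lparr>orderA = L, orderB = M, lower = h, upper = restrict G (carrier M)\<rparr>"
    by simp
  fix g assume g: "g \<in> extensional (carrier M) \<and>
      galois_connection \<lparr>orderA = L, orderB = M, lower = h, upper = g\<rparr>"
  then interpret g: galois_connection "\<lparr>orderA = L, orderB = M, lower = h, upper = g\<rparr>"
    by simp
  show "g = restrict G (carrier M)"
  proof (rule extensionalityI[of _ "carrier M"])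
    fix y assume y: "y \<in> carrier M"
    have gy: "g y \<in> carrier L" "G y \<in> carrier L"
      using g.upper_closed[of y] G y by auto
    have iff: "x \<sqsubseteq>\<^bsub>L\<^esub> g y \<longleftrightarrow> x \<sqsubseteq>\<^bsub>L\<^esub> G y" if "x \<in> carrier L" for x
      using g.galois_property[of x y] adj[of x y] that y by simp
    have "g y = G y"
      using iff[OF gy(1)] iff[OF gy(2)] gy by (intro L.le_antisym) auto
    then show "g y = restrict G (carrier M) y"
      using y by simp
  qed (use g in auto)
qed

text \<open>
  The sublocale of the subspace \<open>topspace X - S\<close>: it consists of the open sets \<open>W\<close> that are largest among
  all open sets with the same trace on that subspace, where \<open>V - W \<subseteq> S\<close> expresses that the trace of
  \<open>V\<close> is contained in the trace of \<open>W\<close>.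
\<close>

definition relative_sublocale :: "'a topology \<Rightarrow> 'a set \<Rightarrow> 'a set set" where
  "relative_sublocale X S = {W. openin X W \<and> (\<forall>V. openin X V \<and> V - W \<subseteq> S \<longrightarrow> V \<subseteq> W)}"

lemma sublocale_set_relative_sublocale: "opens.sublocale_set X (relative_sublocale X S)"
  unfolding opens.sublocale_set_def
proof (intro conjI allI impI ballI)
  let ?T = "relative_sublocale X S"
  show "?T \<subseteq> carrier (opens X)"
    by (auto simp: relative_sublocale_def carrier_opens)
  fix A assume A: "A \<subseteq> ?T"
  then have AX: "A \<subseteq> carrier (opens X)"
    by (auto simp: relative_sublocale_def carrier_opens)
  let ?W = "\<Sqinter>\<^bsub>opens X\<^esub>A"
  have "V \<subseteq> ?W" if V: "openin X V" "V - ?W \<subseteq> S" for V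
  proof -
    have "V \<subseteq> w" if w: "w \<in> A" for w
    proof -
      have "?W \<subseteq> w"
        using opens.inf_lower[OF AX w] by (simp add: le_opens)
      then have "V - w \<subseteq> S"
        using V(2) by blast
      then show ?thesis
        using A w V(1) by (auto simp: relative_sublocale_def)
    qed
    then show ?thesis
      using opens.inf_greatest[OF AX, of V] V(1) by (simp add: carrier_opens le_opens)
  qed
  moreover have "openin X ?W"
    using opens.inf_closed[OF AX] by (simp add: carrier_opens)
  ultimately show "?W \<in> ?T"
    by (simp add: relative_sublocale_def)
next
  let ?T = "relative_sublocale X S"
  fix a w assume a: "a \<in> carrier (opens X)" and w: "w \<in> ?T"
  let ?c = "opens.imp X a w"
  have wX: "w \<in> carrier (opens X)"
    using w by (simp add: relative_sublocale_def carrier_opens)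
  have c: "openin X ?c"
    using opens.imp_closed[of X a w] by (simp add: carrier_opens)
  have adj: "V \<subseteq> ?c \<longleftrightarrow> V \<inter> a \<subseteq> w" if "openin X V" for V
    using opens.le_imp_iff[OF a wX, of V] that a by (simp add: carrier_opens le_opens meet_opens)
  have "V \<subseteq> ?c" if V: "openin X V" "V - ?c \<subseteq> S" for V
  proof -
    have "(V \<inter> a) - w \<subseteq> S"
      using adj[OF c] V(2) by blast
    then have "V \<inter> a \<subseteq> w"
      using w V(1) a by (auto simp: relative_sublocale_def carrier_opens)
    then show ?thesis
      using adj[OF V(1)] by simp
  qed
  then show "?c \<in> ?T"
    using c by (simp add: relative_sublocale_def)
qed

lemma nucleus_relative_sublocale:
  assumes U: "openin X U"
  shows "opens.nucleus X (relative_sublocale X S) U = \<Union>{V. openin X V \<and> V - U \<subseteq> S}"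
    (is "?j = ?G")
proof
  note T = sublocale_set_relative_sublocale[of X S]
  note TX = opens.sublocale_set_subset[OF T]
  have "?G \<in> relative_sublocale X S"
    unfolding relative_sublocale_def
  proof (clarify, intro conjI allI impI)
    show "openin X ?G" by auto
    fix V assume "openin X V \<and> V - ?G \<subseteq> S"
    then have "openin X V" "V - U \<subseteq> S" by auto
    then show "V \<subseteq> ?G" by blast
  qed
  moreover have "U \<subseteq> ?G" using U by blast
  ultimately show "?j \<subseteq> ?G"
    using opens.nucleus_le_iff[OF TX, of U ?G] U by (simp add: carrier_opens le_opens)
  have "U \<subseteq> ?j"
    using opens.le_nucleus[OF TX, of U] U by (simp add: carrier_opens le_opens)
  moreover have "?j \<in> relative_sublocale X S"
    using T by (rule opens.nucleus_mem)
  ultimately have "V \<subseteq> ?j" if "openin X V" "V - U \<subseteq> S" for V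
    using that unfolding relative_sublocale_def by blast
  then show "?G \<subseteq> ?j" by blast
qed

lemma complemented_frame_hom_disc:
  "complemented_frame_hom (opens X) (opens (disc X)) (inverse_image (disc X) id) (\<lambda>U. topspace X - U)"
proof (intro complemented_frame_hom.intro complemented_frame_hom_axioms.intro opens.ambient_frame_axioms)
  have eq: "inverse_image (disc X) id U = U" if "openin X U" for U
    using openin_subset[OF that] by (auto simp: inverse_image_def)
  show "frame_hom (opens X) (opens (disc X)) (inverse_image (disc X) id)"
    unfolding frame_hom_def
  proof (intro conjI allI ballI impI frame_opens)
    show "inverse_image (disc X) id \<in> carrier (opens X) \<rightarrow> carrier (opens (disc X))"
      by (auto simp: carrier_opens inverse_image_def)
    show "inverse_image (disc X) id \<top>\<^bsub>opens X\<^esub> = \<top>\<^bsub>opens (disc X)\<^esub>"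
      by (simp add: top_opens eq)
    show "inverse_image (disc X) id (U \<sqinter>\<^bsub>opens X\<^esub> V) =
        inverse_image (disc X) id U \<sqinter>\<^bsub>opens (disc X)\<^esub> inverse_image (disc X) id V"
      if "U \<in> carrier (opens X)" "V \<in> carrier (opens X)" for U V
      using that by (simp add: carrier_opens eq meet_opens openin_Int openin_subset)
    show "inverse_image (disc X) id (\<Squnion>\<^bsub>opens X\<^esub>\<U>) = \<Squnion>\<^bsub>opens (disc X)\<^esub>(inverse_image (disc X) id ` \<U>)"
      if \<U>: "\<U> \<subseteq> carrier (opens X)" for \<U>
    proof -
      have "inverse_image (disc X) id ` \<U> = id ` \<U>"
        using \<U> by (intro image_cong refl) (simp add: carrier_opens eq subset_iff)
      then have "inverse_image (disc X) id ` \<U> = \<U>"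
        by simp
      moreover have "openin X (\<Union>\<U>)" "\<U> \<subseteq> {U. openin (disc X) U}"
        using \<U> by (auto simp: carrier_opens dest: openin_subset)
      ultimately show ?thesis
        using \<U> by (simp add: carrier_opens sup_opens eq)
    qed
  qed
  show "opens.complements (disc X) (inverse_image (disc X) id U) (topspace X - U)"
    if "U \<in> carrier (opens X)" for U
    using that openin_subset[of X U]
    by (auto simp: opens.complements_def carrier_opens eq meet_opens join_opens top_opens bottom_opens)
qed

text \<open>
  The lift of the identity sends \<open>T\<close> to the union of the sets \<open>j U - U\<close> with \<open>j\<close> the nucleus of \<open>T\<close>.  All
  of these lie in \<open>S\<close> iff \<open>j\<close> is below the nucleus of the relative sublocale, which sends \<open>U\<close> to
  the largest open set \<open>V\<close> with \<open>V - U \<subseteq> S\<close>; this in turn means that \<open>T\<close> contains the relative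
  sublocale.
\<close>

lemma right_adjoint_disc_lift:
  "right_adjoint (Sl_frame (opens X)) (opens (disc X)) (disc_lift X) =
    restrict (relative_sublocale X) (carrier (opens (disc X)))"
proof (rule right_adjoint_eq)
  interpret complemented_frame_hom "opens X" "opens (disc X)" "inverse_image (disc X) id" "\<lambda>U. topspace X - U"
    by (rule complemented_frame_hom_disc)
  have lift: "disc_lift X = restrict explicit_lift (carrier (Sl_frame (opens X)))"
    unfolding disc_lift_def by (rule lift_eq_explicit_lift)
  show "partial_order (Sl_frame (opens X))" "partial_order (opens (disc X))"
    by (rule opens.partial_order_Sl_frame partial_order_opens)+
  show "disc_lift X \<in> carrier (Sl_frame (opens X)) \<rightarrow> carrier (opens (disc X))"
    by (auto simp: lift opens.carrier_Sl_frame)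
  show "relative_sublocale X \<in> carrier (opens (disc X)) \<rightarrow> carrier (Sl_frame (opens X))"
    by (simp add: opens.carrier_Sl_frame sublocale_set_relative_sublocale)
  fix T S assume "T \<in> carrier (Sl_frame (opens X))" and "S \<in> carrier (opens (disc X))"
  then have T: "opens.sublocale_set X T" and S: "S \<subseteq> topspace X"
    by (simp_all add: opens.carrier_Sl_frame carrier_opens)
  let ?R = "relative_sublocale X S"
  note R = sublocale_set_relative_sublocale[of X S]
  note TX = opens.sublocale_set_subset[OF T] and RX = opens.sublocale_set_subset[OF R]
  have j: "openin X (opens.nucleus X T U)" for U
    using opens.nucleus_closed[OF TX, of U] by (simp add: carrier_opens)
  have eq: "inverse_image (disc X) id U = U" if "openin X U" for U
    using openin_subset[OF that] by (auto simp: inverse_image_def)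
  have "disc_lift X T \<sqsubseteq>\<^bsub>opens (disc X)\<^esub> S \<longleftrightarrow> explicit_lift T \<sqsubseteq>\<^bsub>opens (disc X)\<^esub> S"
    using T by (simp add: lift opens.carrier_Sl_frame)
  also have "\<dots> \<longleftrightarrow> (\<forall>U\<in>carrier (opens X). inverse_image (disc X) id (opens.nucleus X T U)
      \<sqsubseteq>\<^bsub>opens (disc X)\<^esub> S \<squnion>\<^bsub>opens (disc X)\<^esub> inverse_image (disc X) id U)"
    using S by (intro explicit_lift_le_iff[OF T]) (simp add: carrier_opens)
  also have "\<dots> \<longleftrightarrow> (\<forall>U. openin X U \<longrightarrow> opens.nucleus X T U \<subseteq> S \<union> U)"
    using S openin_subset[of X] by (simp add: carrier_opens eq j join_opens le_opens)
  also have "\<dots> \<longleftrightarrow> ?R \<subseteq> T"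
  proof
    assume le: "\<forall>U. openin X U \<longrightarrow> opens.nucleus X T U \<subseteq> S \<union> U"
    show "?R \<subseteq> T"
    proof
      fix W assume W: "W \<in> ?R"
      then have WX: "openin X W" by (simp add: relative_sublocale_def)
      then have "opens.nucleus X T W - W \<subseteq> S"
        using le by blast
      then have "opens.nucleus X T W \<subseteq> W"
        using W j by (simp add: relative_sublocale_def)
      then show "W \<in> T"
        using WX by (intro opens.sublocale_set_memI[OF T]) (simp_all add: carrier_opens le_opens)
    qed
  next
    assume sub: "?R \<subseteq> T"
    show "\<forall>U. openin X U \<longrightarrow> opens.nucleus X T U \<subseteq> S \<union> U"
    proof (intro allI impI)
      fix U assume U: "openin X U"
      have "opens.nucleus X ?R U \<in> T"
        using sub opens.nucleus_mem[OF R] by blast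
      then have "opens.nucleus X T U \<subseteq> opens.nucleus X ?R U"
        using opens.nucleus_le_iff[OF TX, of U "opens.nucleus X ?R U"] opens.le_nucleus[OF RX, of U] U
        by (simp add: carrier_opens le_opens)
      also have "\<dots> \<subseteq> S \<union> U"
        using U by (auto simp: nucleus_relative_sublocale)
      finally show "opens.nucleus X T U \<subseteq> S \<union> U" .
    qed
  qed
  finally show "disc_lift X T \<sqsubseteq>\<^bsub>opens (disc X)\<^esub> S \<longleftrightarrow> T \<sqsubseteq>\<^bsub>Sl_frame (opens X)\<^esub> relative_sublocale X S"
    by (simp add: opens.le_Sl_frame)
qed

section \<open>The induced measure\<close>

context hausdorff_content
begin

lemma content_proj_eq: "content_proj X l = inner_ideal"
  by (rule ext) (simp add: content_proj_def inner_ideal_def)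

lemma complemented_frame_hom_content_proj:
  "complemented_frame_hom (opens X) (content_locale X l) (content_proj X l)
    (\<lambda>U. inner_ideal (topspace X - U))"
  unfolding content_proj_eq
proof (intro complemented_frame_hom.intro complemented_frame_hom_axioms.intro opens.ambient_frame_axioms)
  let ?M = "content_locale X l"
  show M: "ambient_frame ?M"
    by (rule ambient_frame.intro) (rule frame_content_locale)
  then interpret M: ambient_frame ?M .
  have closed: "inner_ideal S \<in> carrier ?M" for S
    by (simp add: carrier_content_locale content_ideal_inner_ideal)
  show "frame_hom (opens X) ?M inner_ideal"
    unfolding frame_hom_def
  proof (intro conjI allI ballI impI frame_opens frame_content_locale)
    show "inner_ideal \<in> carrier (opens X) \<rightarrow> carrier ?M"
      using closed by simp
    show "inner_ideal \<top>\<^bsub>opens X\<^esub> = \<top>\<^bsub>?M\<^esub>"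
    proof -
      have "K \<in> inner_ideal (topspace X)" if "compactin X K" for K
        using that compactin_subset_topspace[OF that] by (rule inner_ideal_memI)
      then show ?thesis
        using content_idealD(1)[OF content_ideal_inner_ideal, of _ "topspace X"]
        by (auto simp: top_opens top_content_locale)
    qed
    show "inner_ideal (U \<sqinter>\<^bsub>opens X\<^esub> V) = inner_ideal U \<sqinter>\<^bsub>?M\<^esub> inner_ideal V"
      if "U \<in> carrier (opens X)" "V \<in> carrier (opens X)" for U V
      using that by (simp add: carrier_opens meet_opens meet_content_locale content_ideal_inner_ideal inner_ideal_inter)
    show "inner_ideal (\<Squnion>\<^bsub>opens X\<^esub>\<U>) = \<Squnion>\<^bsub>?M\<^esub>(inner_ideal ` \<U>)" if \<U>: "\<U> \<subseteq> carrier (opens X)" for \<U>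
    proof -
      have sub: "inner_ideal ` \<U> \<subseteq> carrier ?M"
        using closed by auto
      have J: "content_ideal X l (\<Squnion>\<^bsub>?M\<^esub>(inner_ideal ` \<U>))"
        using M.sup_closed[OF sub] by (simp add: carrier_content_locale)
      have "inner_ideal (\<Union>\<U>) = \<Squnion>\<^bsub>?M\<^esub>(inner_ideal ` \<U>)"
      proof
        have "inner_ideal U \<subseteq> \<Squnion>\<^bsub>?M\<^esub>(inner_ideal ` \<U>)" if "U \<in> \<U>" for U
          using M.sup_upper[OF sub, of "inner_ideal U"] that by (simp add: le_content_locale)
        then show "inner_ideal (\<Union>\<U>) \<subseteq> \<Squnion>\<^bsub>?M\<^esub>(inner_ideal ` \<U>)"
          using \<U> by (intro inner_ideal_Union_le[OF J]) (auto simp: carrier_opens)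
        have "\<Squnion>\<^bsub>?M\<^esub>(inner_ideal ` \<U>) \<sqsubseteq>\<^bsub>?M\<^esub> inner_ideal (\<Union>\<U>)"
          using inner_ideal_mono[of _ "\<Union>\<U>"]
          by (intro M.sup_least[OF sub closed]) (auto simp: le_content_locale)
        then show "\<Squnion>\<^bsub>?M\<^esub>(inner_ideal ` \<U>) \<subseteq> inner_ideal (\<Union>\<U>)"
          by (simp add: le_content_locale)
      qed
      then show ?thesis
        using \<U> by (simp add: sup_opens carrier_opens)
    qed
  qed
  show "M.complements (inner_ideal U) (inner_ideal (topspace X - U))" if "U \<in> carrier (opens X)" for U
    using that by (simp add: carrier_opens inner_ideal_complements)
qed

text \<open>
  With \<open>j\<close> the nucleus of the relative sublocale, the lift is the supremum of the ideals
  \<open>inner_ideal (j U - U)\<close>.  Each \<open>j U - U\<close> lies in \<open>S\<close>.  Conversely, a compact \<open>K \<subseteq> S\<close> is closed because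
  \<open>X\<close> is Hausdorff, and for \<open>U = topspace X - K\<close> one has \<open>j U = topspace X\<close>, so that \<open>K\<close> occurs as the
  difference \<open>j U - U\<close>.
\<close>

lemma content_proj_lift_relative_sublocale:
  assumes S: "S \<subseteq> topspace X"
  shows "content_proj_lift X l (relative_sublocale X S) = inner_ideal S"
proof -
  let ?M = "content_locale X l" and ?T = "relative_sublocale X S"
  interpret complemented_frame_hom "opens X" ?M "content_proj X l" "\<lambda>U. inner_ideal (topspace X - U)"
    by (rule complemented_frame_hom_content_proj)
  note T = sublocale_set_relative_sublocale[of X S]
  let ?j = "opens.nucleus X ?T"
  have piece: "content_proj X l (?j U) \<sqinter>\<^bsub>?M\<^esub> inner_ideal (topspace X - U) = inner_ideal (?j U \<inter> (topspace X - U))" for U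
    by (simp add: content_proj_eq meet_content_locale content_ideal_inner_ideal inner_ideal_inter)
  have "explicit_lift ?T = inner_ideal S"
  proof
    have "explicit_lift ?T \<sqsubseteq>\<^bsub>?M\<^esub> inner_ideal S"
      unfolding explicit_lift_def
    proof (rule M.sup_least[OF explicit_lift_subset[OF T]])
      show "inner_ideal S \<in> carrier ?M"
        by (simp add: carrier_content_locale content_ideal_inner_ideal)
      fix Z assume "Z \<in> (\<lambda>U. content_proj X l (?j U) \<sqinter>\<^bsub>?M\<^esub> inner_ideal (topspace X - U)) ` carrier (opens X)"
      then obtain U where U: "openin X U" and Z: "Z = inner_ideal (?j U \<inter> (topspace X - U))"
        by (auto simp: piece carrier_opens)
      have "?j U \<inter> (topspace X - U) \<subseteq> S"
        using U by (auto simp: nucleus_relative_sublocale)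
      then show "Z \<sqsubseteq>\<^bsub>?M\<^esub> inner_ideal S"
        by (simp add: Z le_content_locale inner_ideal_mono)
    qed
    then show "explicit_lift ?T \<subseteq> inner_ideal S"
      by (simp add: le_content_locale)
    have "K \<in> explicit_lift ?T" if K: "compactin X K" "K \<subseteq> S" for K
    proof -
      let ?U = "topspace X - K"
      have U: "openin X ?U" using K(1) by (rule openin_minus_compact)
      have KX: "K \<subseteq> topspace X" using K(1) by (rule compactin_subset_topspace)
      have "topspace X \<subseteq> ?j ?U"
        using K(2) U by (auto simp: nucleus_relative_sublocale intro!: exI[of _ "topspace X"])
      then have "K \<in> inner_ideal (?j ?U \<inter> (topspace X - ?U))"
        using K(1) KX by (intro inner_ideal_memI) auto
      moreover have "inner_ideal (?j ?U \<inter> (topspace X - ?U)) \<subseteq> explicit_lift ?T"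
        using explicit_lift_upper[OF T, of ?U] U by (simp add: piece carrier_opens le_content_locale)
      ultimately show ?thesis by blast
    qed
    moreover have "content_ideal X l (explicit_lift ?T)"
      using explicit_lift_closed[OF T] by (simp add: carrier_content_locale)
    ultimately show "inner_ideal S \<subseteq> explicit_lift ?T"
      unfolding inner_ideal_def by (intro hull_minimal) auto
  qed
  then show ?thesis
    unfolding content_proj_lift_def lift_eq_explicit_lift
    by (simp add: opens.carrier_Sl_frame T)
qed

end

theorem corollary8p22:
  fixes X :: "'a topology" and l :: "'a set \<Rightarrow> real" and S :: "'a set"
  assumes "Hausdorff_space X"
    and "regular_content X l"
    and "S \<subseteq> topspace X"
  shows "induced_measure X l S = (SUP K\<in>{K. compactin X K \<and> K \<subseteq> S}. ennreal (l K))"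
proof -
  interpret hausdorff_content X l
    using assms(1,2) by unfold_locales
  have "right_adjoint (Sl_frame (opens X)) (opens (disc X)) (disc_lift X) S = relative_sublocale X S"
    using assms(3) by (simp add: right_adjoint_disc_lift carrier_opens)
  then show ?thesis
    unfolding induced_measure_def sublocale_measure_def
    by (simp add: content_proj_lift_relative_sublocale assms(3) inner_measure_inner_ideal)
qed

end
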